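(* Let $n\ge1$, let $M$ be a nonempty connected open subset of $\mathbb{R}^n$ with its standard flat connection $D$ and volume form $\omega=du^1\wedge\dots\wedge du^n$. Let $Q\in C^\infty(M)$ and let $A:M\to\mathbb{R}^{n+1}$ be a centroaffine immersion satisfying $A^{\ast}(\mu)=\kappa\,\omega$ for a nonzero constant $\kappa$. Then a nonempty connected component $\Sigma$ of a level set of the function $F:M\times(\mathbb{R}^{n+1})^{\ast}\to\mathbb{R}$ defined by $F(u,x)=\langle A(u),x\rangle+Q(u)$ is an affine sphere if and only if the image of $A$ is contained in an (affine) hyperplane of $\mathbb{R}^{n+1}$.
   Context: $\mathbb{R}^{n+1}$ has its standard flat connection and determinant volume form $\Psi$; $(\mathbb{R}^{n+1})^{\ast}$ has the dual flat connection and dual parallel volume form $\Psi^{\ast}$; $\langle\cdot,\cdot\rangle$ is the pairing. $\mathbb{X}$ is the radial (position) vector field on $\mathbb{R}^{n+1}$ and $\mu=\iota(\mathbb X)\Psi$. An immersion $A:M\to\mathbb{R}^{n+1}$ is centroaffine if its image omits the origin and is everywhere transverse to $\mathbb X$. $M\times(\mathbb{R}^{n+1})^{\ast}$ carries the product flat connection $\nabla$ and the parallel volume form $\Upsilon=\omega\wedge\Psi^{\ast}$; under the stated hypotheses the level sets of $F$ are smooth nondegenerate hypersurfaces. For a hypersurface $\Sigma$, a transversal $T$ determines $\bar\nabla,h,S,\tau$ on $\Sigma$ by $\nabla_XY=\bar\nabla_XY+h(X,Y)T$, $\nabla_XT=-S(X)+\tau(X)T$ for $X,Y$ tangent to $\Sigma$;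 $\Sigma$ is nondegenerate if $h$ is nondegenerate. The equiaffine normal $\mathsf W$ of a nondegenerate hypersurface is the transversal, unique up to sign, such that $|\iota(\mathsf W)\Upsilon|$ equals the volume density of the corresponding $h$ and is parallel for the corresponding $\bar\nabla$; the corresponding $S$ is the equiaffine shape operator. A nondegenerate hypersurface is an affine sphere if its equiaffine shape operator is a multiple of the identity. *)

theory Defs
  imports "HOL-Analysis.Analysis"
begin

section \<open>Smooth maps\<close>

text \<open>Intended for open \<open>S\<close> in a finite-dimensional space: differentiability at every point
  together with the same for all directional derivatives.\<close>

primrec Ck_on :: "nat \<Rightarrow> 'a set \<Rightarrow> ('a::real_normed_vector \<Rightarrow> 'b::real_normed_vector) \<Rightarrow> bool" where
  "Ck_on 0 S f \<longleftrightarrow> continuous_on S f"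
| "Ck_on (Suc k) S f \<longleftrightarrow>
     (\<forall>x\<in>S. f differentiable (at x)) \<and> (\<forall>v. Ck_on k S (\<lambda>x. frechet_derivative f (at x) v))"

definition smooth_on :: "'a set \<Rightarrow> ('a::real_normed_vector \<Rightarrow> 'b::real_normed_vector) \<Rightarrow> bool" where
  "smooth_on S f \<longleftrightarrow> (\<forall>k. Ck_on k S f)"

text \<open>For an embedded submanifold \<open>\<Sigma>\<close>, which need not be open: local smooth extensions exist.\<close>

definition smooth_along :: "'a set \<Rightarrow> ('a::real_normed_vector \<Rightarrow> 'b::real_normed_vector) \<Rightarrow> bool" where
  "smooth_along \<Sigma> f \<longleftrightarrow>
     (\<forall>p\<in>\<Sigma>. \<exists>U g. open U \<and> p \<in> U \<and> smooth_on U g \<and> (\<forall>q\<in>\<Sigma> \<inter> U. g q = f q))"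


section \<open>Hypersurfaces of a Euclidean space and their tangent fields\<close>

definition smooth_hypersurface :: "'v::euclidean_space set \<Rightarrow> bool" where
  "smooth_hypersurface \<Sigma> \<longleftrightarrow>
     (\<forall>p\<in>\<Sigma>. \<exists>U (f :: 'v \<Rightarrow> real). open U \<and> p \<in> U \<and> smooth_on U f \<and>
        \<Sigma> \<inter> U = {q \<in> U. f q = 0} \<and> (\<forall>q\<in>U. \<exists>v. frechet_derivative f (at q) v \<noteq> 0))"

definition tangent_space :: "'v::euclidean_space set \<Rightarrow> 'v \<Rightarrow> 'v set" where
  "tangent_space \<Sigma> p =
     {v. \<exists>\<gamma> e. e > 0 \<and> smooth_on {-e<..<e} \<gamma> \<and> \<gamma> ` {-e<..<e} \<subseteq> \<Sigma> \<and> \<gamma> 0 = p \<and>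
              (\<gamma> has_vector_derivative v) (at (0::real))}"

definition tangent_field :: "'v::euclidean_space set \<Rightarrow> ('v \<Rightarrow> 'v) \<Rightarrow> bool" where
  "tangent_field \<Sigma> Y \<longleftrightarrow> smooth_along \<Sigma> Y \<and> (\<forall>p\<in>\<Sigma>. Y p \<in> tangent_space \<Sigma> p)"

definition tangent_frame :: "'v::euclidean_space set \<Rightarrow> ('k \<Rightarrow> 'v \<Rightarrow> 'v) \<Rightarrow> bool" where
  "tangent_frame \<Sigma> E \<longleftrightarrow>
     (\<forall>i. tangent_field \<Sigma> (E i)) \<and>
     (\<forall>p\<in>\<Sigma>. inj (\<lambda>i. E i p) \<and> independent (range (\<lambda>i. E i p)) \<and>
            span (range (\<lambda>i. E i p)) = tangent_space \<Sigma> p)"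


section \<open>Data induced by a transversal\<close>

definition transversal :: "'v::euclidean_space set \<Rightarrow> ('v \<Rightarrow> 'v) \<Rightarrow> bool" where
  "transversal \<Sigma> T \<longleftrightarrow> smooth_along \<Sigma> T \<and> (\<forall>p\<in>\<Sigma>. T p \<notin> tangent_space \<Sigma> p)"

text \<open>The flat derivative of a field along \<open>\<Sigma>\<close>, for \<open>v\<close> tangent to \<open>\<Sigma>\<close> at \<open>p\<close>. The derivative within
  \<open>\<Sigma>\<close> is not unique as a linear map on the ambient space, but all of them agree on tangent vectors.\<close>

definition flat_deriv ::
  "'v::euclidean_space set \<Rightarrow> ('v \<Rightarrow> 'b::real_normed_vector) \<Rightarrow> 'v \<Rightarrow> 'v \<Rightarrow> 'b" where
  "flat_deriv \<Sigma> Y p v = frechet_derivative Y (at p within \<Sigma>) v"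

text \<open>The components of \<open>w\<close> in the splitting of the ambient space into the tangent space at \<open>p\<close>
  and the line spanned by \<open>T p\<close>.\<close>

definition transv_coeff :: "'v::euclidean_space set \<Rightarrow> ('v \<Rightarrow> 'v) \<Rightarrow> 'v \<Rightarrow> 'v \<Rightarrow> real" where
  "transv_coeff \<Sigma> T p w = (THE c. w - c *\<^sub>R T p \<in> tangent_space \<Sigma> p)"

definition tang_part :: "'v::euclidean_space set \<Rightarrow> ('v \<Rightarrow> 'v) \<Rightarrow> 'v \<Rightarrow> 'v \<Rightarrow> 'v" where
  "tang_part \<Sigma> T p w = w - transv_coeff \<Sigma> T p w *\<^sub>R T p"

definition induced_conn ::
  "'v::euclidean_space set \<Rightarrow> ('v \<Rightarrow> 'v) \<Rightarrow> ('v \<Rightarrow> 'v) \<Rightarrow> 'v \<Rightarrow> 'v \<Rightarrow> 'v" where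
  "induced_conn \<Sigma> T Y p v = tang_part \<Sigma> T p (flat_deriv \<Sigma> Y p v)"

text \<open>The form \<open>h\<close> as a tensor on the tangent space at \<open>p\<close>: the value on \<open>v, w\<close> is computed with an
  arbitrary tangent field \<open>Y\<close>, defined near \<open>p\<close>, that extends \<open>w\<close>.\<close>

definition second_form ::
  "'v::euclidean_space set \<Rightarrow> ('v \<Rightarrow> 'v) \<Rightarrow> 'v \<Rightarrow> 'v \<Rightarrow> 'v \<Rightarrow> real" where
  "second_form \<Sigma> T p v w =
     (THE c. \<exists>U Y. open U \<and> p \<in> U \<and> tangent_field (\<Sigma> \<inter> U) Y \<and> Y p = w \<and>
               c = transv_coeff \<Sigma> T p (flat_deriv \<Sigma> Y p v))"

definition shape_op ::
  "'v::euclidean_space set \<Rightarrow> ('v \<Rightarrow> 'v) \<Rightarrow> 'v \<Rightarrow> 'v \<Rightarrow> 'v" where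
  "shape_op \<Sigma> T p v = - tang_part \<Sigma> T p (flat_deriv \<Sigma> T p v)"

definition nondegenerate_form ::
  "'v::euclidean_space set \<Rightarrow> ('v \<Rightarrow> 'v \<Rightarrow> 'v \<Rightarrow> real) \<Rightarrow> bool" where
  "nondegenerate_form \<Sigma> h \<longleftrightarrow>
     (\<forall>p\<in>\<Sigma>. \<forall>v\<in>tangent_space \<Sigma> p. (\<forall>w\<in>tangent_space \<Sigma> p. h p v w = 0) \<longrightarrow> v = 0)"

text \<open>\<open>T\<close> ranges over locally defined transversals, since a hypersurface need not admit a global
  one; nondegeneracy of \<open>h\<close> does not depend on \<open>T\<close>.\<close>

definition nondegenerate_hypersurface :: "'v::euclidean_space set \<Rightarrow> bool" where
  "nondegenerate_hypersurface \<Sigma> \<longleftrightarrow>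
     smooth_hypersurface \<Sigma> \<and>
     (\<forall>U T. open U \<and> transversal (\<Sigma> \<inter> U) T \<longrightarrow>
            nondegenerate_form (\<Sigma> \<inter> U) (second_form (\<Sigma> \<inter> U) T))"


section \<open>Equiaffine normal and affine spheres\<close>

text \<open>An alternating form of degree \<open>k + 1\<close> is a function of families indexed by \<open>'k option\<close>, the
  first slot being \<open>None\<close>.\<close>

definition interior_product :: "'v \<Rightarrow> (('k option \<Rightarrow> 'v) \<Rightarrow> real) \<Rightarrow> ('k \<Rightarrow> 'v) \<Rightarrow> real" where
  "interior_product w \<Omega> X = \<Omega> (case_option w X)"

definition volume_density ::
  "('v \<Rightarrow> 'v \<Rightarrow> 'v \<Rightarrow> real) \<Rightarrow> 'v \<Rightarrow> ('k::finite \<Rightarrow> 'v) \<Rightarrow> real" where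
  "volume_density h p X = sqrt \<bar>det (\<chi> i j. h p (X i) (X j))\<bar>"

text \<open>A density \<open>\<rho>\<close> is parallel for the connection induced by \<open>T\<close> if in every local frame \<open>E\<close>, with
  connection matrix \<open>\<theta>\<close> in the direction \<open>v\<close>, the derivative of \<open>\<rho>(E)\<close> along \<open>v\<close> is
  \<open>tr \<theta>\<close> times \<open>\<rho>(E)\<close>.\<close>

definition parallel_density ::
  "'v::euclidean_space set \<Rightarrow> ('v \<Rightarrow> 'v) \<Rightarrow> ('v \<Rightarrow> ('k::finite \<Rightarrow> 'v) \<Rightarrow> real) \<Rightarrow> bool" where
  "parallel_density \<Sigma> T \<rho> \<longleftrightarrow>
     (\<forall>p\<in>\<Sigma>. \<forall>U (E :: 'k \<Rightarrow> 'v \<Rightarrow> 'v). open U \<and> p \<in> U \<and> tangent_frame (\<Sigma> \<inter> U) E \<longrightarrow>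
        (\<forall>v\<in>tangent_space \<Sigma> p. \<forall>\<theta> :: 'k \<Rightarrow> 'k \<Rightarrow> real.
           (\<forall>j. induced_conn \<Sigma> T (E j) p v = (\<Sum>i\<in>UNIV. \<theta> i j *\<^sub>R E i p)) \<longrightarrow>
           flat_deriv \<Sigma> (\<lambda>q. \<rho> q (\<lambda>i. E i q)) p v = (\<Sum>i\<in>UNIV. \<theta> i i) * \<rho> p (\<lambda>i. E i p)))"

definition equiaffine_normal ::
  "(('k::finite option \<Rightarrow> 'v::euclidean_space) \<Rightarrow> real) \<Rightarrow> 'v set \<Rightarrow> ('v \<Rightarrow> 'v) \<Rightarrow> bool" where
  "equiaffine_normal \<Omega> \<Sigma> W \<longleftrightarrow>
     transversal \<Sigma> W \<and>
     (\<forall>p\<in>\<Sigma>. \<forall>X. range X \<subseteq> tangent_space \<Sigma> p \<longrightarrow>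
        \<bar>interior_product (W p) \<Omega> X\<bar> = volume_density (second_form \<Sigma> W) p X) \<and>
     parallel_density \<Sigma> W (\<lambda>p X. \<bar>interior_product (W p) \<Omega> X\<bar>)"

definition affine_sphere ::
  "(('k::finite option \<Rightarrow> 'v::euclidean_space) \<Rightarrow> real) \<Rightarrow> 'v set \<Rightarrow> bool" where
  "affine_sphere \<Omega> \<Sigma> \<longleftrightarrow>
     nondegenerate_hypersurface \<Sigma> \<and>
     (\<exists>W. equiaffine_normal \<Omega> \<Sigma> W \<and>
          (\<forall>p\<in>\<Sigma>. \<exists>H. \<forall>v\<in>tangent_space \<Sigma> p. shape_op \<Sigma> W p v = H *\<^sub>R v))"


section \<open>The ambient spaces\<close>

text \<open>\<open>real^('n option)\<close> is the space of dimension \<open>n + 1\<close>. It also serves as its own dual, in the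
  coordinates dual to the standard ones, so that the pairing is the inner product.\<close>

definition omega_form :: "('n::finite \<Rightarrow> real^'n) \<Rightarrow> real" where
  "omega_form X = det (\<chi> i. X i)"

definition Psi_form :: "('n::finite option \<Rightarrow> real^('n option)) \<Rightarrow> real" where
  "Psi_form X = det (\<chi> i. X i)"

text \<open>The form \<open>\<omega> \<and> \<Psi>\<^sup>*\<close> as a determinant of coordinates. Its slots are ordered \<open>None\<close>, \<open>Inl\<close>, \<open>Inr\<close>; matching
  \<open>None\<close> with the \<open>None\<close> coordinate of the dual factor moves that coordinate in front of the \<open>n\<close>
  coordinates on \<open>M\<close>, which accounts for the sign.\<close>

definition ambient_coord ::
  "(real^'n::finite) \<times> (real^('n option)) \<Rightarrow> ('n + 'n) option \<Rightarrow> real" where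
  "ambient_coord z s =
     (case s of None \<Rightarrow> snd z $ None | Some (Inl i) \<Rightarrow> fst z $ i | Some (Inr i) \<Rightarrow> snd z $ Some i)"

definition Upsilon_form ::
  "(('n::finite + 'n) option \<Rightarrow> (real^'n) \<times> (real^('n option))) \<Rightarrow> real" where
  "Upsilon_form X = (-1) ^ CARD('n) * det (\<chi> r s. ambient_coord (X r) s)"

definition mu_form :: "real^('n::finite option) \<Rightarrow> ('n \<Rightarrow> real^('n option)) \<Rightarrow> real" where
  "mu_form x = interior_product x Psi_form"

definition pullback_form ::
  "('a::real_normed_vector \<Rightarrow> 'b::real_normed_vector) \<Rightarrow> ('b \<Rightarrow> ('k \<Rightarrow> 'b) \<Rightarrow> real) \<Rightarrow>
   'a \<Rightarrow> ('k \<Rightarrow> 'a) \<Rightarrow> real" where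
  "pullback_form A \<alpha> u X = \<alpha> (A u) (\<lambda>i. frechet_derivative A (at u) (X i))"

definition centroaffine_immersion ::
  "(real^'n::finite) set \<Rightarrow> (real^'n \<Rightarrow> real^('n option)) \<Rightarrow> bool" where
  "centroaffine_immersion M A \<longleftrightarrow>
     smooth_on M A \<and> (\<forall>u\<in>M. inj (frechet_derivative A (at u))) \<and> 0 \<notin> A ` M \<and>
     (\<forall>u\<in>M. A u \<notin> range (frechet_derivative A (at u)))"

definition pairing_function ::
  "(real^'n::finite \<Rightarrow> real^('n option)) \<Rightarrow> (real^'n \<Rightarrow> real) \<Rightarrow>
   (real^'n) \<times> (real^('n option)) \<Rightarrow> real" where
  "pairing_function A Q = (\<lambda>(u, x). A u \<bullet> x + Q u)"

end

theory Submission
  imports Defs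
begin

text \<open>Let \<open>e\<close> be the conormal of \<open>A\<close>, given by \<open>\<langle>A, e\<rangle> = 1\<close> and \<open>\<langle>A\<^sub>i, e\<rangle> = 0\<close>, and let \<open>N = (0, e)\<close>, so that
  \<open>dF(N) = 1\<close> and \<open>Hess F\<close> vanishes when one argument is \<open>N\<close>. Because \<open>A\<^sup>*\<mu> = \<kappa> \<omega>\<close>, the volume of
  \<open>(N, X)\<close> for a tangent frame \<open>X\<close> is \<open>\<bar>\<kappa>\<bar>\<^sup>-\<^sup>1\<close> times the square root of \<open>\<bar>det Hess F(X, X)\<bar>\<close>. The volume
  condition on an equiaffine normal \<open>W\<close> thus says \<open>\<bar>dF(W)\<bar> ^ (n + 1) = \<bar>\<kappa>\<bar>\<close>; parallelism then forces \<open>Hess F(W, \<cdot>) = 0\<close> on tangent vectors, so \<open>W\<close>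
  is a constant multiple of \<open>N\<close>. Since \<open>N\<close> depends on \<open>u\<close> only, the shape operator kills the vertical
  tangent vectors, so it is a multiple of the identity only if it is zero, which means that \<open>e\<close> is
  constant, that is, that \<open>A\<close> lies in the hyperplane \<open>\<langle>\<cdot>, e\<rangle> = 1\<close>.\<close>

section \<open>Smooth maps\<close>

text \<open>The exponent n + 1 has two sources. The second fundamental form of \<open>W\<close> is
  \<open>- Hess F / dF(W)\<close> on a tangent space of dimension 2n, so its volume density carries
  the factor \<open>\<bar>dF(W)\<bar>\<close> to the power -n, whereas contracting the volume form
  with \<open>W\<close> is linear in \<open>dF(W)\<close>. Parallelism acts through
  \<open>\<tau>\<close>: the volume of a frame \<open>(W, E)\<close> changes at the rate
  \<open>\<tau> + tr \<theta>\<close>, so a parallel density means \<open>\<tau> = 0\<close>, that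
  is \<open>dF(D_v W) = 0\<close>. Differentiating \<open>dF(W)\<close>, whose derivative is zero,
  gives \<open>Hess F(v, W) + dF(D_v W) = 0\<close>, so the Hessian term vanishes too, and
  nondegeneracy on tangent vectors removes the tangential part of \<open>W\<close>. Nonzero vertical
  tangent vectors exist because the fibre has dimension n + 1 \<ge> 2. No choice of component
  arises: \<open>F\<close> is affine on fibres with slope 1 in the direction \<open>N\<close>, so
  sliding along \<open>N\<close> retracts the connected domain onto the level set. The same
  retraction provides the curves that determine the tangent spaces.\<close>

lemma Ck_on_subset: "Ck_on k S f \<Longrightarrow> T \<subseteq> S \<Longrightarrow> Ck_on k T f"
  by (induction k arbitrary: f) (auto intro: continuous_on_subset)

lemma Ck_on_cong:
  assumes "open S" "\<And>x. x \<in> S \<Longrightarrow> f x = g x" "Ck_on k S f"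
  shows "Ck_on k S g"
  using assms(2,3)
proof (induction k arbitrary: f g)
  case 0
  then show ?case by (metis Ck_on.simps(1) continuous_on_cong)
next
  case (Suc k)
  have d: "g differentiable at x" "frechet_derivative f (at x) = frechet_derivative g (at x)"
    if "x \<in> S" for x
  proof -
    have f: "f differentiable at x" using Suc.prems(2) that by simp
    show "frechet_derivative f (at x) = frechet_derivative g (at x)"
      by (rule frechet_derivative_transform_within_open[OF f assms(1) that Suc.prems(1)])
    show "g differentiable at x"
      using f assms(1) that Suc.prems(1) unfolding differentiable_def
      by (meson has_derivative_transform_within_open)
  qed
  show ?case
    unfolding Ck_on.simps
  proof (intro conjI ballI allI)
    fix v
    show "Ck_on k S (\<lambda>x. frechet_derivative g (at x) v)"
      by (rule Suc.IH[of "\<lambda>x. frechet_derivative f (at x) v"]) (use d Suc.prems in auto)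
  qed (rule d)
qed

lemma Ck_on_SucD: "Ck_on (Suc k) S f \<Longrightarrow> Ck_on k S f"
proof (induction k arbitrary: f)
  case 0
  then show ?case
    by (auto intro!: continuous_at_imp_continuous_on differentiable_imp_continuous_within)
qed auto

lemma Ck_on_SucI:
  assumes "open S" "\<And>x. x \<in> S \<Longrightarrow> (f has_derivative f' x) (at x)"
    and "\<And>v. Ck_on k S (\<lambda>x. f' x v)"
  shows "Ck_on (Suc k) S f"
proof -
  have "f' x = frechet_derivative f (at x)" if "x \<in> S" for x
    using assms(2)[OF that] by (rule frechet_derivative_at)
  then have "Ck_on k S (\<lambda>x. frechet_derivative f (at x) v)" for v
    by (intro Ck_on_cong[OF assms(1) _ assms(3)[of v]]) simp
  then show ?thesis
    using assms(2) by (auto simp: differentiable_def)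
qed

lemma Ck_on_const: "open S \<Longrightarrow> Ck_on k S (\<lambda>x. c)"
  by (induction k arbitrary: c) simp_all

lemma Ck_on_has_derivative:
  "Ck_on (Suc k) S f \<Longrightarrow> x \<in> S \<Longrightarrow> (f has_derivative frechet_derivative f (at x)) (at x)"
  using frechet_derivative_works by auto

lemma Ck_on_linear:
  assumes "bounded_linear L" "open S" "Ck_on k S f"
  shows "Ck_on k S (\<lambda>x. L (f x))"
  using assms(3)
proof (induction k arbitrary: f)
  case 0
  then show ?case using assms(1) by (auto intro: bounded_linear.continuous_on)
next
  case (Suc k)
  show ?case
  proof (rule Ck_on_SucI[OF assms(2)])
    fix x assume "x \<in> S"
    show "((\<lambda>x. L (f x)) has_derivative (\<lambda>v. L (frechet_derivative f (at x) v))) (at x)"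
      by (rule bounded_linear.has_derivative[OF assms(1) Ck_on_has_derivative[OF Suc.prems \<open>x \<in> S\<close>]])
  qed (use Suc in auto)
qed

lemma Ck_on_add:
  assumes "open S" "Ck_on k S f" "Ck_on k S g"
  shows "Ck_on k S (\<lambda>x. f x + g x)"
  using assms(2,3)
proof (induction k arbitrary: f g)
  case 0
  then show ?case by (auto intro: continuous_intros)
next
  case (Suc k)
  show ?case
  proof (rule Ck_on_SucI[OF assms(1)])
    fix x assume "x \<in> S"
    show "((\<lambda>x. f x + g x) has_derivative
      (\<lambda>v. frechet_derivative f (at x) v + frechet_derivative g (at x) v)) (at x)"
      by (intro has_derivative_add Ck_on_has_derivative[OF _ \<open>x \<in> S\<close>]) (rule Suc.prems)+
  qed (use Suc in auto)
qed

lemma Ck_on_bilinear: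
  assumes "bounded_bilinear B" "open S" "Ck_on k S f" "Ck_on k S g"
  shows "Ck_on k S (\<lambda>x. B (f x) (g x))"
  using assms(3,4)
proof (induction k arbitrary: f g)
  case 0
  then show ?case using assms(1) by (auto intro: bounded_bilinear.continuous_on)
next
  case (Suc k)
  \<comment> \<open>The product rule pairs each derivative, of class k, with the other
    undifferentiated factor, so the factors are needed at class k as well.\<close>
  note sub = Ck_on_SucD[OF Suc.prems(1)] Ck_on_SucD[OF Suc.prems(2)]
  show ?case
  proof (rule Ck_on_SucI[OF assms(2)])
    fix x assume "x \<in> S"
    show "((\<lambda>x. B (f x) (g x)) has_derivative
      (\<lambda>v. B (f x) (frechet_derivative g (at x) v) + B (frechet_derivative f (at x) v) (g x))) (at x)"
      by (intro bounded_bilinear.FDERIV[OF assms(1)] Ck_on_has_derivative[OF _ \<open>x \<in> S\<close>])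
        (rule Suc.prems)+
  qed (intro Ck_on_add assms Suc.IH sub, use Suc.prems in auto)
qed

lemma Ck_on_sum:
  assumes "open S" "\<And>i. i \<in> I \<Longrightarrow> Ck_on k S (f i)"
  shows "Ck_on k S (\<lambda>x. \<Sum>i\<in>I. f i x)"
  using assms(2)
  by (induction I rule: infinite_finite_induct) (auto intro: assms(1) Ck_on_const Ck_on_add)

lemma Ck_on_prod:
  fixes f :: "'i \<Rightarrow> 'a::real_normed_vector \<Rightarrow> real"
  assumes "open S" "\<And>i. i \<in> I \<Longrightarrow> Ck_on k S (f i)"
  shows "Ck_on k S (\<lambda>x. \<Prod>i\<in>I. f i x)"
  using assms(2)
  by (induction I rule: infinite_finite_induct)
    (auto intro: assms(1) Ck_on_const Ck_on_bilinear[OF bounded_bilinear_mult])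

lemma Ck_on_id: "open S \<Longrightarrow> Ck_on k S (\<lambda>x. x)"
  by (cases k) (auto simp: Ck_on_const)

lemma Ck_on_compose:
  fixes f :: "'a::real_normed_vector \<Rightarrow> 'b::euclidean_space"
  assumes "open S" "open T" "f ` S \<subseteq> T" "Ck_on k S f" "Ck_on k T g"
  shows "Ck_on k S (\<lambda>x. g (f x))"
  using assms(4,5)
proof (induction k arbitrary: g)
  case 0
  then show ?case using assms(3) by (auto intro: continuous_on_compose2)
next
  case (Suc k)
  \<comment> \<open>In the chain rule the direction in which \<open>g\<close> is differentiated
    moves with \<open>x\<close>, while \<open>Ck_on\<close> controls only fixed directions.
    Expanding in a basis separates the two.\<close>
  have D: "frechet_derivative g (at (f x)) v = (\<Sum>b\<in>Basis. (v \<bullet> b) *\<^sub>R frechet_derivative g (at (f x)) b)"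
    if "x \<in> S" for x v
  proof -
    have "linear (frechet_derivative g (at (f x)))"
      using Suc.prems(2) assms(3) that by (auto intro: linear_frechet_derivative)
    then have "frechet_derivative g (at (f x)) (\<Sum>b\<in>Basis. (v \<bullet> b) *\<^sub>R b) =
        (\<Sum>b\<in>Basis. (v \<bullet> b) *\<^sub>R frechet_derivative g (at (f x)) b)"
      by (simp add: linear_sum linear_scale)
    then show ?thesis
      by (simp add: euclidean_representation)
  qed
  show ?case
  proof (rule Ck_on_SucI[OF assms(1)])
    fix x assume x: "x \<in> S"
    have "((\<lambda>x. g (f x)) has_derivative (\<lambda>v. frechet_derivative g (at (f x)) (frechet_derivative f (at x) v))) (at x)"
      using has_derivative_compose[OF Ck_on_has_derivative[OF Suc.prems(1) x]
          Ck_on_has_derivative[OF Suc.prems(2), of "f x"]] x assms(3) by blast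
    then show "((\<lambda>x. g (f x)) has_derivative (\<lambda>v. \<Sum>b\<in>Basis. (frechet_derivative f (at x) v \<bullet> b) *\<^sub>R
        frechet_derivative g (at (f x)) b)) (at x)"
      by (rule has_derivative_eq_rhs) (rule ext, rule D[OF x])
  next
    fix v
    have "Ck_on k S (\<lambda>x. frechet_derivative g (at (f x)) b)" for b
      using Suc.IH[of "\<lambda>y. frechet_derivative g (at y) b"] Ck_on_SucD[OF Suc.prems(1)] Suc.prems(2)
      by auto
    then show "Ck_on k S (\<lambda>x. \<Sum>b\<in>Basis. (frechet_derivative f (at x) v \<bullet> b) *\<^sub>R
        frechet_derivative g (at (f x)) b)"
      by (intro Ck_on_sum assms Ck_on_bilinear[OF bounded_bilinear_scaleR]
          Ck_on_linear[OF bounded_linear_inner_left]) (use Suc.prems in auto)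
  qed
qed

lemma smooth_on_subset: "smooth_on S f \<Longrightarrow> T \<subseteq> S \<Longrightarrow> smooth_on T f"
  by (auto simp: smooth_on_def intro: Ck_on_subset)

lemma smooth_on_const: "open S \<Longrightarrow> smooth_on S (\<lambda>x. c)"
  by (auto simp: smooth_on_def intro: Ck_on_const)

lemma smooth_on_id: "open S \<Longrightarrow> smooth_on S (\<lambda>x. x)"
  by (auto simp: smooth_on_def intro: Ck_on_id)

lemma smooth_on_linear: "bounded_linear L \<Longrightarrow> open S \<Longrightarrow> smooth_on S f \<Longrightarrow> smooth_on S (\<lambda>x. L (f x))"
  by (auto simp: smooth_on_def intro: Ck_on_linear)

lemma smooth_on_add:
  "open S \<Longrightarrow> smooth_on S f \<Longrightarrow> smooth_on S g \<Longrightarrow> smooth_on S (\<lambda>x. f x + g x)"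
  by (auto simp: smooth_on_def intro: Ck_on_add)

lemma smooth_on_bilinear:
  "bounded_bilinear B \<Longrightarrow> open S \<Longrightarrow> smooth_on S f \<Longrightarrow> smooth_on S g \<Longrightarrow> smooth_on S (\<lambda>x. B (f x) (g x))"
  by (auto simp: smooth_on_def intro: Ck_on_bilinear)

lemmas smooth_on_scaleR = smooth_on_bilinear[OF bounded_bilinear_scaleR]
lemmas smooth_on_inner = smooth_on_bilinear[OF bounded_bilinear_inner]
lemmas smooth_on_mult = smooth_on_bilinear[OF bounded_bilinear_mult]

lemma smooth_on_diff:
  "open S \<Longrightarrow> smooth_on S f \<Longrightarrow> smooth_on S g \<Longrightarrow> smooth_on S (\<lambda>x. f x - g x)"
  using smooth_on_add[of S f "\<lambda>x. - g x"] smooth_on_linear[OF bounded_linear_minus[OF bounded_linear_ident], of S g]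
  by simp

lemma smooth_on_sum:
  "open S \<Longrightarrow> (\<And>i. i \<in> I \<Longrightarrow> smooth_on S (f i)) \<Longrightarrow> smooth_on S (\<lambda>x. \<Sum>i\<in>I. f i x)"
  by (auto simp: smooth_on_def intro: Ck_on_sum)

lemma smooth_on_prod:
  fixes f :: "'i \<Rightarrow> 'a::real_normed_vector \<Rightarrow> real"
  shows "open S \<Longrightarrow> (\<And>i. i \<in> I \<Longrightarrow> smooth_on S (f i)) \<Longrightarrow> smooth_on S (\<lambda>x. \<Prod>i\<in>I. f i x)"
  by (auto simp: smooth_on_def intro: Ck_on_prod)

lemma smooth_on_compose:
  fixes f :: "'a::real_normed_vector \<Rightarrow> 'b::euclidean_space"
  shows "open S \<Longrightarrow> open T \<Longrightarrow> f ` S \<subseteq> T \<Longrightarrow> smooth_on S f \<Longrightarrow> smooth_on T g \<Longrightarrow> smooth_on S (\<lambda>x. g (f x))"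
  by (auto simp: smooth_on_def intro: Ck_on_compose)

lemma smooth_on_Pair:
  assumes "open S" "smooth_on S f" "smooth_on S g"
  shows "smooth_on S (\<lambda>x. (f x, g x))"
proof -
  have "smooth_on S (\<lambda>x. (f x, 0) + (0, g x))"
    by (intro smooth_on_add assms smooth_on_linear[of "\<lambda>y. (y, 0)"] smooth_on_linear[of "\<lambda>y. (0, y)"]
        bounded_linear_Pair bounded_linear_ident bounded_linear_zero)
  then show ?thesis by simp
qed

lemma smooth_on_vec_lambda:
  fixes f :: "'i::finite \<Rightarrow> 'a::real_normed_vector \<Rightarrow> real"
  assumes "open S" "\<And>i. smooth_on S (f i)"
  shows "smooth_on S (\<lambda>x. \<chi> i. f i x)"
proof -
  have "(\<chi> i. f i x) = (\<Sum>i\<in>UNIV. f i x *\<^sub>R axis i 1)" for x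
    by (simp add: vec_eq_iff axis_def if_distrib sum.delta cong: if_cong)
  then show ?thesis
    by (auto intro!: smooth_on_sum smooth_on_scaleR smooth_on_const assms)
qed

lemma smooth_on_det:
  fixes m :: "'i::finite \<Rightarrow> 'i \<Rightarrow> 'a::real_normed_vector \<Rightarrow> real"
  assumes "open S" "\<And>i j. smooth_on S (m i j)"
  shows "smooth_on S (\<lambda>x. det (\<chi> i j. m i j x))"
  unfolding det_def
  by (auto intro!: smooth_on_sum smooth_on_mult smooth_on_const smooth_on_prod assms)

lemma smooth_on_differentiable: "smooth_on S f \<Longrightarrow> x \<in> S \<Longrightarrow> f differentiable (at x)"
  unfolding smooth_on_def by (drule spec[of _ "Suc 0"]) simp

lemma smooth_on_has_derivative:
  "smooth_on S f \<Longrightarrow> x \<in> S \<Longrightarrow> (f has_derivative frechet_derivative f (at x)) (at x)"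
  by (drule (1) smooth_on_differentiable) (simp add: frechet_derivative_works)

lemma smooth_on_frechet_derivative:
  assumes "smooth_on S f"
  shows "smooth_on S (\<lambda>x. frechet_derivative f (at x) v)"
  unfolding smooth_on_def
proof
  fix k
  have "Ck_on (Suc k) S f" using assms by (simp add: smooth_on_def)
  then show "Ck_on k S (\<lambda>x. frechet_derivative f (at x) v)" by simp
qed

lemma smooth_on_continuous_on: "smooth_on S f \<Longrightarrow> continuous_on S f"
  unfolding smooth_on_def by (drule spec[of _ 0]) simp

section \<open>Smooth fields along a subset\<close>

lemma smooth_along_restrict: "smooth_on O' f \<Longrightarrow> open O' \<Longrightarrow> \<Sigma> \<subseteq> O' \<Longrightarrow> smooth_along \<Sigma> f"
  unfolding smooth_along_def by (intro ballI exI[of _ O'] exI[of _ f]) auto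

lemma smooth_along_differentiable:
  assumes "smooth_along \<Sigma> f" "p \<in> \<Sigma>"
  shows "f differentiable (at p within \<Sigma>)"
proof -
  have "\<exists>U g. open U \<and> p \<in> U \<and> smooth_on U g \<and> (\<forall>q\<in>\<Sigma> \<inter> U. g q = f q)"
    using assms(1) unfolding smooth_along_def by (rule bspec) (rule assms(2))
  then obtain U g where U: "open U" "p \<in> U" "smooth_on U g" "\<forall>q\<in>\<Sigma> \<inter> U. g q = f q"
    by (elim exE conjE)
  obtain g' where "(g has_derivative g') (at p within \<Sigma>)"
    using smooth_on_has_derivative[OF U(3,2)] has_derivative_at_withinI by blast
  moreover obtain d where "d > 0" "ball p d \<subseteq> U"
    using U(1,2) open_contains_ball by blast
  ultimately have "(f has_derivative g') (at p within \<Sigma>)"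
    using U(4) assms(2) by (intro has_derivative_transform_within[of g g' p \<Sigma> d f]) (auto simp: dist_commute subset_iff)
  then show ?thesis by (auto simp: differentiable_def)
qed

lemma smooth_along_subset:
  assumes "smooth_along \<Sigma> f" "\<Sigma>' \<subseteq> \<Sigma>"
  shows "smooth_along \<Sigma>' f"
  unfolding smooth_along_def
proof
  fix p assume "p \<in> \<Sigma>'"
  then have "p \<in> \<Sigma>" using assms(2) by blast
  with assms(1)[unfolded smooth_along_def]
  have "\<exists>U g. open U \<and> p \<in> U \<and> smooth_on U g \<and> (\<forall>q\<in>\<Sigma> \<inter> U. g q = f q)"
    by (rule bspec)
  then obtain U g where "open U" "p \<in> U" "smooth_on U g" "\<forall>q\<in>\<Sigma> \<inter> U. g q = f q"
    by (elim exE conjE)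
  then show "\<exists>U g. open U \<and> p \<in> U \<and> smooth_on U g \<and> (\<forall>q\<in>\<Sigma>' \<inter> U. g q = f q)"
    using assms(2) by (intro exI[of _ U] exI[of _ g]) auto
qed

section \<open>Determinants\<close>

lemma sum_UNIV_option: "(\<Sum>x\<in>UNIV. f x) = f None + (\<Sum>i\<in>UNIV. f (Some (i::'a::finite)))"
  by (simp add: UNIV_option_conv sum.reindex)

lemma sum_UNIV_sum:
  "(\<Sum>x\<in>UNIV. f x) = (\<Sum>i\<in>UNIV. f (Inl (i::'a::finite))) + (\<Sum>i\<in>UNIV. f (Inr (i::'b::finite)))"
  by (simp add: UNIV_Plus_UNIV[symmetric] sum.Plus del: UNIV_Plus_UNIV)

text \<open>Up to reordering the indices this is the block matrix diag(B, 1). It compares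
  determinants over different index types.\<close>

definition embed_mat :: "('b::finite \<Rightarrow> 'a::finite) \<Rightarrow> real^'b^'b \<Rightarrow> real^'a^'a" where
  "embed_mat f B = (\<chi> i j. if i \<in> range f \<and> j \<in> range f then B $ inv f i $ inv f j else of_bool (i = j))"

lemma embed_mat_mult:
  assumes "inj f"
  shows "embed_mat f (A ** B) = embed_mat f A ** embed_mat f B"
proof -
  have "(\<Sum>k\<in>UNIV. embed_mat f A $ i $ k * embed_mat f B $ k $ j) = embed_mat f (A ** B) $ i $ j" for i j
  proof (cases "i \<in> range f")
    case False
    then have "(\<Sum>k\<in>UNIV. embed_mat f A $ i $ k * embed_mat f B $ k $ j)
        = (\<Sum>k\<in>UNIV. if i = k then embed_mat f B $ k $ j else 0)"
      by (intro sum.cong) (auto simp: embed_mat_def)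
    then show ?thesis
      using False by (simp add: embed_mat_def)
  next
    case True
    then obtain a where a: "i = f a" by blast
    have "(\<Sum>k\<in>UNIV. embed_mat f A $ i $ k * embed_mat f B $ k $ j)
        = (\<Sum>k\<in>range f. embed_mat f A $ i $ k * embed_mat f B $ k $ j)"
      by (intro sum.mono_neutral_right) (auto simp: embed_mat_def a)
    also have "\<dots> = (\<Sum>k\<in>UNIV. A $ a $ k * embed_mat f B $ f k $ j)"
      using assms by (subst sum.reindex) (auto simp: embed_mat_def a)
    also have "\<dots> = embed_mat f (A ** B) $ i $ j"
    proof (cases "j \<in> range f")
      case False
      then have "embed_mat f B $ f k $ j = 0" for k by (auto simp: embed_mat_def)
      with False show ?thesis by (auto simp: a embed_mat_def)
    next
      case True
      then show ?thesis using assms by (auto simp: a embed_mat_def matrix_matrix_mult_def)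
    qed
    finally show ?thesis .
  qed
  then show ?thesis by (simp add: vec_eq_iff matrix_matrix_mult_def)
qed

lemma det_swap_columns:
  assumes "m \<noteq> n"
  shows "det (\<chi> i j. mat 1 $ i $ Transposition.transpose m n j :: real^'a::finite^'a) = -1"
  using det_permute_columns[of "Transposition.transpose m n" "mat 1 :: real^'a^'a"] assms
  by (simp add: permutes_swap_id sign_swap_id)

lemma det_idplus:
  assumes "m \<noteq> n"
  shows "det (\<chi> i j. of_bool (i = m \<and> j = n \<or> i = j) :: real^'a::finite^'a) = 1"
proof -
  have "(\<chi> i j. of_bool (i = m \<and> j = n \<or> i = j) :: real^'a^'a)
    = (\<chi> k. if k = m then row m (mat 1) + 1 *s row n (mat 1) else row k (mat 1))"
    using assms by (auto simp: vec_eq_iff row_def mat_def)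
  then show ?thesis using det_row_operation[OF assms, of "mat 1 :: real^'a^'a" 1] by simp
qed

text \<open>Both sides are multiplicative, so induction over elementary matrices suffices; the
  embedding turns each elementary matrix into one of the same kind.\<close>

lemma det_embed_mat:
  fixes f :: "'b::finite \<Rightarrow> 'a::finite"
  assumes "inj f"
  shows "det (embed_mat f B) = det B"
proof (rule induct_matrix_elementary_alt[of "\<lambda>B. det (embed_mat f B) = det B"])
  fix A B assume "det (embed_mat f A) = det A" "det (embed_mat f B) = det B"
  then show "det (embed_mat f (A ** B)) = det (A ** B)" by (simp add: embed_mat_mult[OF assms] det_mul)
next
  fix A :: "real^'b^'b" and i assume zero_row: "row i A = 0"
  have "row (f i) (embed_mat f A) = 0"
    using zero_row assms by (auto simp: row_def vec_eq_iff embed_mat_def)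
  then show "det (embed_mat f A) = det A" using zero_row det_zero_row by metis
next
  fix A :: "real^'b^'b" assume diagonal: "\<And>i j. i \<noteq> j \<Longrightarrow> A $ i $ j = 0"
  have "det (embed_mat f A) = (\<Prod>i\<in>UNIV. embed_mat f A $ i $ i)"
    using diagonal assms by (intro det_diagonal) (auto simp: embed_mat_def inj_eq)
  also have "\<dots> = (\<Prod>i\<in>range f. embed_mat f A $ i $ i)"
    by (intro prod.mono_neutral_right) (auto simp: embed_mat_def)
  also have "\<dots> = (\<Prod>i\<in>UNIV. A $ i $ i)"
    using assms by (subst prod.reindex) (auto simp: embed_mat_def)
  also have "\<dots> = det A"
    using diagonal by (intro det_diagonal[symmetric])
  finally show "det (embed_mat f A) = det A" .
next
  fix m n :: 'b assume swap1: "m \<noteq> n"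
  have t: "Transposition.transpose (f m) (f n) (f j) = f (Transposition.transpose m n j)" for j
    using assms by (auto simp: Transposition.transpose_def inj_eq)
  have t': "Transposition.transpose (f m) (f n) j = j" if "j \<notin> range f" for j
    using that by (auto simp: Transposition.transpose_def)
  have "embed_mat f (\<chi> i j. mat 1 $ i $ Transposition.transpose m n j)
     = (\<chi> i j. mat 1 $ i $ Transposition.transpose (f m) (f n) j)"
  proof -
    have "embed_mat f (\<chi> i j. mat 1 $ i $ Transposition.transpose m n j) $ i $ j
        = mat 1 $ i $ Transposition.transpose (f m) (f n) j" for i j
    proof (cases "j \<in> range f")
      case True
      then obtain b where b: "j = f b" by blast
      show ?thesis using assms unfolding b t by (auto simp: embed_mat_def mat_def inj_eq)
    next
      case False
      then show ?thesis unfolding t'[OF False] by (auto simp: embed_mat_def mat_def)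
    qed
    then show ?thesis by (simp add: vec_eq_iff)
  qed
  moreover have "f m \<noteq> f n" using assms swap1 by (simp add: inj_eq)
  ultimately show "det (embed_mat f (\<chi> i j. mat 1 $ i $ Transposition.transpose m n j)) = det (\<chi> i j. mat 1 $ i $ Transposition.transpose m n j :: real^'b^'b)" using swap1 by (simp add: det_swap_columns)
next
  fix m n :: 'b assume idplus: "m \<noteq> n"
  have eq: "embed_mat f (\<chi> i j. of_bool (i = m \<and> j = n \<or> i = j))
     = (\<chi> i j. of_bool (i = f m \<and> j = f n \<or> i = j))"
    using assms by (auto simp: vec_eq_iff embed_mat_def inj_eq)
  have fmn: "f m \<noteq> f n" using assms idplus by (simp add: inj_eq)
  show "det (embed_mat f (\<chi> i j. of_bool (i = m \<and> j = n \<or> i = j))) = det (\<chi> i j. of_bool (i = m \<and> j = n \<or> i = j) :: real^'b^'b)" by (simp only: eq det_idplus[OF idplus] det_idplus[OF fmn])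
qed

text \<open>In the Leibniz expansion the product rule differentiates one factor at a time; the terms
  in which the factor of row \<open>k\<close> is differentiated form the determinant with that row
  replaced.\<close>

lemma has_derivative_det:
  fixes m :: "'i::finite \<Rightarrow> 'i \<Rightarrow> 'a::real_normed_vector \<Rightarrow> real"
  assumes "\<And>i j. (m i j has_derivative m' i j) (at p within S)"
  shows "((\<lambda>x. det (\<chi> i j. m i j x)) has_derivative
    (\<lambda>v. \<Sum>k\<in>UNIV. det (\<chi> i. if i = k then (\<chi> j. m' k j v) else (\<chi> j. m i j p)))) (at p within S)"
proof -
  have prod_row: "(\<Prod>i\<in>UNIV. (if i = k then (\<chi> j. m' k j v) else (\<chi> j. m i j p)) $ \<pi> i)
      = m' k (\<pi> k) v * (\<Prod>i\<in>UNIV - {k}. m i (\<pi> i) p)" for k \<pi> v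
    by (subst prod.remove[of UNIV k]) auto
  have "((\<lambda>x. \<Sum>\<pi> | \<pi> permutes UNIV. of_int (sign \<pi>) * (\<Prod>i\<in>UNIV. m i (\<pi> i) x)) has_derivative
    (\<lambda>v. \<Sum>\<pi> | \<pi> permutes UNIV. of_int (sign \<pi>) *
      (\<Sum>k\<in>UNIV. m' k (\<pi> k) v * (\<Prod>i\<in>UNIV - {k}. m i (\<pi> i) p)))) (at p within S)"
    by (intro has_derivative_sum has_derivative_mult_right has_derivative_prod assms)
  then show ?thesis
    unfolding det_def vec_lambda_beta prod_row by (simp add: sum_distrib_left sum.swap[of _ _ UNIV])
qed

text \<open>By linearity in row \<open>k\<close> only the summand \<open>l = k\<close> survives,
  since every other one has two equal rows. Summed over \<open>k\<close>, this turns the derivative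
  of a determinant into a trace.\<close>

lemma det_replace_row_combination:
  fixes A :: "real^'i::finite^'i"
  shows "det (\<chi> i. if i = k then (\<Sum>l\<in>UNIV. \<Theta> l *s (A $ l)) else A $ i) = \<Theta> k * det A"
proof -
  have single: "det (\<chi> i. if i = k then A $ l else A $ i) = (if l = k then det A else 0)" for l
  proof (cases "l = k")
    case True
    then have "(\<chi> i. if i = k then A $ l else A $ i) = A" by (auto simp: vec_eq_iff)
    with True show ?thesis by simp
  next
    case False
    then show ?thesis
      using det_identical_rows[of l k "\<chi> i. if i = k then A $ l else A $ i"] by (simp add: row_def)
  qed
  have "det (\<chi> i. if i = k then (\<Sum>l\<in>UNIV. \<Theta> l *s (A $ l)) else A $ i)
     = (\<Sum>l\<in>UNIV. \<Theta> l * det (\<chi> i. if i = k then A $ l else A $ i))"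
    using det_linear_row_sum[of UNIV k "\<lambda>i l. \<Theta> l *s (A $ l)" "\<lambda>i. A $ i"]
      det_row_mul[of k _ "\<lambda>i. A $ _" "\<lambda>i. A $ i"] by simp
  also have "\<dots> = (\<Sum>l\<in>UNIV. if l = k then \<Theta> k * det A else 0)"
    unfolding single by (intro sum.cong) auto
  finally show ?thesis by simp
qed

text \<open>The determinant is computed, up to sign, from \<open>X\<^sup>-\<^sup>1 = T X T\<close> with a fixed matrix \<open>T\<close>.\<close>

lemma abs_det_antidiagonal_block:
  fixes H :: "'n::finite \<Rightarrow> 'n \<Rightarrow> real"
  defines "X \<equiv> (\<chi> r s. case r of None \<Rightarrow> of_bool (s = None)
     | Some (Inl i) \<Rightarrow> (case s of None \<Rightarrow> 0 | Some (Inl j) \<Rightarrow> H i j | Some (Inr j) \<Rightarrow> of_bool (i = j))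
     | Some (Inr i) \<Rightarrow> of_bool (s = Some (Inl i))) :: real^('n + 'n) option^('n + 'n) option"
  shows "\<bar>det X\<bar> = 1"
proof -
  define T :: "real^('n + 'n) option^('n + 'n) option" where
    "T = (\<chi> r s. case r of None \<Rightarrow> of_bool (s = None)
     | Some (Inl i) \<Rightarrow> of_bool (s = Some (Inr i)) | Some (Inr i) \<Rightarrow> - of_bool (s = Some (Inl i)))"
  define Z :: "real^('n + 'n) option^('n + 'n) option" where
    "Z = (\<chi> r s. case r of None \<Rightarrow> of_bool (s = None)
     | Some (Inl i) \<Rightarrow> of_bool (s = Some (Inr i))
     | Some (Inr i) \<Rightarrow> (case s of None \<Rightarrow> 0 | Some (Inl j) \<Rightarrow> of_bool (i = j) | Some (Inr j) \<Rightarrow> - H i j))"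
  define D :: "real^('n + 'n) option^('n + 'n) option" where
    "D = (\<chi> r s. case r of None \<Rightarrow> of_bool (s = None) | Some i \<Rightarrow> - of_bool (s = Some i))"
  define Y :: "real^('n + 'n) option^('n + 'n) option" where
    "Y = (\<chi> r s. case r of None \<Rightarrow> of_bool (s = None)
     | Some (Inl i) \<Rightarrow> of_bool (s = Some (Inl i))
     | Some (Inr i) \<Rightarrow> (case s of None \<Rightarrow> 0 | Some (Inl j) \<Rightarrow> - H i j | Some (Inr j) \<Rightarrow> - of_bool (i = j)))"
  note calc = vec_eq_iff matrix_matrix_mult_def mat_def split_option_all split_sum_all
    sum_UNIV_option sum_UNIV_sum of_bool_def if_distrib[of "\<lambda>x. x * _"] if_distrib[of "\<lambda>x. _ * x"]
  have "X ** Z = mat 1"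
    by (simp add: X_def Z_def calc sum.delta sum.delta' sum_negf cong: if_cong)
  moreover have "T ** X = Y"
    by (simp add: X_def Y_def T_def calc sum.delta sum.delta' sum_negf cong: if_cong)
  moreover have "Y ** T = Z"
    by (simp add: Z_def Y_def T_def calc sum.delta sum.delta' sum_negf cong: if_cong)
  moreover have "T ** T = D"
    by (simp add: D_def T_def calc sum.delta sum.delta' sum_negf cong: if_cong)
  moreover have "D ** D = mat 1"
    by (simp add: D_def calc sum.delta sum.delta' sum_negf cong: if_cong)
  \<comment> \<open>\<open>det T\<close> enters the first equation only through its square, and that
    square is nonnegative with square 1, hence equal to 1.\<close>
  ultimately have 1: "det X * (det T * det X * det T) = 1" and 2: "(det T * det T) * (det T * det T) = 1"
    by (metis det_I det_mul)+
  from 2 have "(det T * det T)\<^sup>2 = 1" by (simp add: power2_eq_square)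
  moreover have "det T * det T \<ge> 0" by simp
  ultimately have "det T * det T = 1"
    unfolding power2_eq_1_iff by auto
  moreover have "(det T * det T) * (det X)\<^sup>2 = 1" using 1 by (simp add: power2_eq_square algebra_simps)
  ultimately have "(det X)\<^sup>2 = 1" by simp
  then show ?thesis unfolding power2_eq_1_iff by auto
qed

section \<open>The conormal and the Hessian\<close>

text \<open>Along a curve in \<open>\<Sigma>\<close> with velocity \<open>v\<close>, every
  derivative within \<open>\<Sigma>\<close> yields, by the chain rule, the derivative of the same
  function of one variable, and that one is unique. So \<open>flat_deriv\<close>, although defined
  by a choice, can be computed from any derivative at hand.\<close>

lemma flat_deriv_eq:
  assumes "(Y has_derivative D) (at p within \<Sigma>)" "v \<in> tangent_space \<Sigma> p"
  shows "flat_deriv \<Sigma> Y p v = D v"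
proof -
  obtain \<gamma> e where e: "e > 0" and \<gamma>: "\<gamma> ` {-e<..<e} \<subseteq> \<Sigma>" "\<gamma> 0 = p"
      "(\<gamma> has_vector_derivative v) (at (0::real))"
    using assms(2) unfolding tangent_space_def mem_Collect_eq by (elim exE conjE) (rule that)
  have 0: "(\<gamma> has_derivative (\<lambda>r. r *\<^sub>R v)) (at 0 within {-e<..<e})"
    using \<gamma>(3) unfolding has_vector_derivative_def by (rule has_derivative_at_withinI)
  have comp: "((\<lambda>t. Y (\<gamma> t)) has_derivative (\<lambda>r. D' (r *\<^sub>R v))) (at 0)"
    if "(Y has_derivative D') (at p within \<Sigma>)" for D'
  proof -
    have "(Y has_derivative D') (at (\<gamma> 0) within \<gamma> ` {-e<..<e})"
      using that \<gamma>(1,2) by (auto intro: has_derivative_subset)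
    from has_derivative_in_compose[OF 0 this]
    have "((\<lambda>t. Y (\<gamma> t)) has_derivative (\<lambda>r. D' (r *\<^sub>R v))) (at 0 within {-e<..<e})" .
    moreover have "at (0::real) within {-e<..<e} = at 0"
      by (rule at_within_open) (use e in auto)
    ultimately show ?thesis by (simp only:)
  qed
  have "(Y has_derivative frechet_derivative Y (at p within \<Sigma>)) (at p within \<Sigma>)"
    unfolding frechet_derivative_works[symmetric] differentiable_def by (rule exI[of _ D]) (rule assms(1))
  from has_derivative_unique[OF comp[OF this] comp[OF assms(1)]]
  have "frechet_derivative Y (at p within \<Sigma>) (1 *\<^sub>R v) = D (1 *\<^sub>R v)" by (rule fun_cong)
  then show ?thesis by (simp add: flat_deriv_def)
qed

lemma flat_deriv_Int:
  assumes "open U" "p \<in> U"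
  shows "flat_deriv (\<Sigma> \<inter> U) Y p v = flat_deriv \<Sigma> Y p v"
proof -
  have "at p within (\<Sigma> \<inter> U) = at p within \<Sigma>"
    by (rule at_within_nhd[OF assms(2,1)]) blast
  then show ?thesis by (simp add: flat_deriv_def)
qed

lemma smooth_along_has_derivative:
  assumes "smooth_along \<Sigma> f" "p \<in> \<Sigma>"
  shows "(f has_derivative flat_deriv \<Sigma> f p) (at p within \<Sigma>)"
  using smooth_along_differentiable[OF assms] unfolding flat_deriv_def by (simp add: frechet_derivative_works)

lemma frechet_coordinates:
  fixes f :: "real^'k::finite \<Rightarrow> 'b::real_normed_vector"
  assumes "f differentiable (at u)"
  shows "frechet_derivative f (at u) w = (\<Sum>i\<in>UNIV. w $ i *\<^sub>R frechet_derivative f (at u) (axis i 1))"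
proof -
  have lin: "linear (frechet_derivative f (at u))"
    using assms by (rule linear_frechet_derivative)
  have "w = (\<Sum>i\<in>UNIV. w $ i *\<^sub>R axis i 1)"
    by (simp add: vec_eq_iff axis_def if_distrib sum.delta cong: if_cong)
  then have "frechet_derivative f (at u) w = frechet_derivative f (at u) (\<Sum>i\<in>UNIV. w $ i *\<^sub>R axis i 1)"
    by simp
  also have "\<dots> = (\<Sum>i\<in>UNIV. w $ i *\<^sub>R frechet_derivative f (at u) (axis i 1))"
    by (simp add: linear_sum[OF lin] linear_scale[OF lin])
  finally show ?thesis .
qed

lemma smooth_on_component: "open S \<Longrightarrow> smooth_on S f \<Longrightarrow> smooth_on S (\<lambda>x. f x $ i)"
  for f :: "'a::real_normed_vector \<Rightarrow> real^'k::finite"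
  by (rule smooth_on_linear[OF bounded_linear_vec_nth])

section \<open>The pairing function, its gradient and its Hessian\<close>

locale pairing_data =
  fixes M :: "(real^'n::finite) set"
    and Q :: "real^'n \<Rightarrow> real"
    and A :: "real^'n \<Rightarrow> real^('n option)"
    and \<kappa> c :: real
  assumes open_M: "open M"
    and smooth_Q: "smooth_on M Q"
    and centroaffine: "centroaffine_immersion M A"
    and kappa_nz: "\<kappa> \<noteq> 0"
    and pullback: "\<forall>u\<in>M. \<forall>X. pullback_form A mu_form u X = \<kappa> * omega_form X"
begin

definition Ai :: "'n \<Rightarrow> real^'n \<Rightarrow> real^('n option)" where
  "Ai i u = frechet_derivative A (at u) (axis i 1)"

definition Qi :: "'n \<Rightarrow> real^'n \<Rightarrow> real" where
  "Qi i u = frechet_derivative Q (at u) (axis i 1)"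

text \<open>The rows follow the slot order of \<open>Psi_form\<close>, so that the determinant is
  \<open>\<Psi>(y, A_1, ..., A_n)\<close>; at \<open>y = A u\<close> it is the coefficient of the
  pulled back \<open>\<mu>\<close>.\<close>

definition fmat :: "real^'n \<Rightarrow> real^('n option) \<Rightarrow> real^('n option)^('n option)" where
  "fmat u y = (\<chi> r. case r of None \<Rightarrow> y | Some i \<Rightarrow> Ai i u)"

text \<open>Coordinates of the functional
  \<open>y \<mapsto> \<Psi>(y, A_1, ..., A_n) / \<kappa>\<close>. It is 1 on \<open>A\<close> by the
  volume hypothesis and 0 on each \<open>A_i\<close> because of a repeated row; the closed formula
  makes smoothness immediate.\<close>

definition conormal :: "real^'n \<Rightarrow> real^('n option)" where
  "conormal u = (\<chi> k. (1 / \<kappa>) * det (fmat u (axis k 1)))"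

definition total_space :: "((real^'n) \<times> (real^('n option))) set" where
  "total_space = M \<times> UNIV"

definition F :: "(real^'n) \<times> (real^('n option)) \<Rightarrow> real" where
  "F = pairing_function A Q"

definition N :: "(real^'n) \<times> (real^('n option)) \<Rightarrow> (real^'n) \<times> (real^('n option))" where
  "N q = (0, conormal (fst q))"

text \<open>The gradient of \<open>F\<close> for the product inner product: \<open>dF(v)\<close>
  becomes \<open>G q \<bullet> v\<close>, and the Hessian becomes the derivative of \<open>G\<close>
  paired with the second argument.\<close>

definition G :: "(real^'n) \<times> (real^('n option)) \<Rightarrow> (real^'n) \<times> (real^('n option))" where
  "G q = ((\<chi> i. Ai i (fst q) \<bullet> snd q + Qi i (fst q)), A (fst q))"

definition hess :: "(real^'n) \<times> (real^('n option)) \<Rightarrow> (real^'n) \<times> (real^('n option)) \<Rightarrow>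
    (real^'n) \<times> (real^('n option)) \<Rightarrow> real" where
  "hess p v w = frechet_derivative G (at p) v \<bullet> w"

definition L :: "((real^'n) \<times> (real^('n option))) set" where
  "L = {p \<in> total_space. F p = c}"

lemma smooth_A: "smooth_on M A"
  using centroaffine by (simp add: centroaffine_immersion_def)

lemma smooth_Ai: "smooth_on M (Ai i)"
  unfolding Ai_def[abs_def] by (rule smooth_on_frechet_derivative[OF smooth_A])

lemma smooth_Qi: "smooth_on M (Qi i)"
  unfolding Qi_def[abs_def] by (rule smooth_on_frechet_derivative[OF smooth_Q])

lemma frechet_zero:
  "smooth_on M f \<Longrightarrow> u \<in> M \<Longrightarrow> frechet_derivative f (at u) 0 = 0" for f :: "real^'n \<Rightarrow> 'b::real_normed_vector"
  by (rule linear_0[OF linear_frechet_derivative[OF smooth_on_differentiable]])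

lemma DA: "u \<in> M \<Longrightarrow> frechet_derivative A (at u) w = (\<Sum>i\<in>UNIV. w $ i *\<^sub>R Ai i u)"
  unfolding Ai_def by (rule frechet_coordinates) (rule smooth_on_differentiable[OF smooth_A])

lemma DQ: "u \<in> M \<Longrightarrow> frechet_derivative Q (at u) w = (\<Sum>i\<in>UNIV. w $ i * Qi i u)"
  unfolding Qi_def using frechet_coordinates[OF smooth_on_differentiable[OF smooth_Q], of u w] by simp

lemma det_fmat_A:
  assumes "u \<in> M"
  shows "det (fmat u (A u)) = \<kappa>"
proof -
  have "pullback_form A mu_form u (\<lambda>i. axis i 1) = \<kappa> * omega_form (\<lambda>i. axis i 1 :: real^'n)"
    by (rule pullback[rule_format, OF assms])
  moreover have "(\<chi> i. axis i 1) = (mat 1 :: real^'n^'n)"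
    by (simp add: vec_eq_iff mat_def axis_def)
  then have "omega_form (\<lambda>i. axis i 1 :: real^'n) = 1"
    by (simp only: omega_form_def det_I)
  moreover have "pullback_form A mu_form u (\<lambda>i. axis i 1) = det (fmat u (A u))"
    by (simp only: pullback_form_def mu_form_def interior_product_def Psi_form_def fmat_def Ai_def)
  ultimately show ?thesis by simp
qed

lemma inner_conormal: "conormal u \<bullet> y = det (fmat u y) / \<kappa>"
proof -
  have fm: "fmat u y = (\<chi> r. if r = None then y else fmat u 0 $ r)" for y
    by (auto simp: fmat_def vec_eq_iff split: option.split)
  have "y = (\<Sum>k\<in>UNIV. y $ k *s axis k 1)"
    by (simp add: vec_eq_iff axis_def if_distrib sum.delta cong: if_cong)
  then have "fmat u y = (\<chi> r. if r = None then (\<Sum>k\<in>UNIV. y $ k *s axis k 1) else fmat u 0 $ r)"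
    using fm[of y] by metis
  then have "det (fmat u y) = (\<Sum>k\<in>UNIV. y $ k * det (fmat u (axis k 1)))"
    using det_linear_row_sum[of UNIV None "\<lambda>r k. y $ k *s axis k 1" "\<lambda>r. fmat u 0 $ r"]
      det_row_mul[of None _ "\<lambda>r. axis _ 1" "\<lambda>r. fmat u 0 $ r"]
    by (simp add: fm[of "axis _ 1"])
  then show ?thesis
    by (simp add: inner_vec_def conormal_def sum_divide_distrib mult.commute)
qed

lemma conormal_A: "u \<in> M \<Longrightarrow> conormal u \<bullet> A u = 1"
  by (simp add: inner_conormal det_fmat_A kappa_nz)

lemma conormal_Ai: "conormal u \<bullet> Ai i u = 0"
proof -
  have "det (fmat u (Ai i u)) = 0"
    by (rule det_identical_rows[of None "Some i"]) (simp_all add: row_def fmat_def)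
  then show ?thesis by (simp add: inner_conormal)
qed

lemma conormal_DA: "u \<in> M \<Longrightarrow> conormal u \<bullet> frechet_derivative A (at u) w = 0"
  by (simp add: DA inner_sum_right conormal_Ai)

lemma smooth_conormal: "smooth_on M conormal"
proof -
  have fm: "fmat u y = (\<chi> r j. case r of None \<Rightarrow> y $ j | Some i \<Rightarrow> Ai i u $ j)" for u y
    by (auto simp: fmat_def vec_eq_iff split: option.split)
  show ?thesis
    unfolding conormal_def[abs_def] fm
  proof (intro smooth_on_vec_lambda smooth_on_mult smooth_on_const smooth_on_det open_M)
    fix k r :: "'n option" and j :: "'n option"
    show "smooth_on M (\<lambda>x. case r of None \<Rightarrow> axis k 1 $ j | Some i \<Rightarrow> Ai i x $ j)"
      by (cases r) (auto intro!: smooth_on_const smooth_on_component smooth_Ai open_M)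
  qed
qed

lemma open_dom: "open total_space"
  unfolding total_space_def by (intro open_Times open_M open_UNIV)

lemma fst_dom: "q \<in> total_space \<Longrightarrow> fst q \<in> M"
  by (auto simp: total_space_def)

lemma smooth_on_fst: "smooth_on M f \<Longrightarrow> smooth_on total_space (\<lambda>q. f (fst q))"
  by (rule smooth_on_compose[OF open_dom open_M _ smooth_on_linear[OF bounded_linear_fst open_dom smooth_on_id[OF open_dom]]])
    (auto simp: total_space_def)

lemma smooth_on_snd: "smooth_on total_space snd"
  by (rule smooth_on_linear[OF bounded_linear_snd open_dom smooth_on_id[OF open_dom]])

lemma smooth_N: "smooth_on total_space N"
  unfolding N_def[abs_def]
  by (intro smooth_on_Pair smooth_on_const smooth_on_fst smooth_conormal open_dom)

lemma smooth_G: "smooth_on total_space G"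
  unfolding G_def[abs_def]
  by (intro smooth_on_Pair smooth_on_vec_lambda smooth_on_add smooth_on_inner smooth_on_fst smooth_Ai
      smooth_Qi smooth_A smooth_on_snd open_dom)

lemma smooth_F: "smooth_on total_space F"
  unfolding F_def pairing_function_def case_prod_beta'
  by (intro smooth_on_add smooth_on_inner smooth_on_fst smooth_Q smooth_A smooth_on_snd open_dom)

lemma F_has_derivative:
  assumes "q \<in> total_space"
  shows "(F has_derivative (\<lambda>v. G q \<bullet> v)) (at q)"
proof -
  have [derivative_intros]: "((\<lambda>q. A (fst q)) has_derivative (\<lambda>v. frechet_derivative A (at (fst q)) (fst v))) (at q)"
    by (rule has_derivative_compose[OF has_derivative_fst[OF has_derivative_ident]
      smooth_on_has_derivative[OF smooth_A fst_dom[OF assms]]])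
  have [derivative_intros]: "((\<lambda>q. Q (fst q)) has_derivative (\<lambda>v. frechet_derivative Q (at (fst q)) (fst v))) (at q)"
    by (rule has_derivative_compose[OF has_derivative_fst[OF has_derivative_ident]
      smooth_on_has_derivative[OF smooth_Q fst_dom[OF assms]]])
  have "((\<lambda>q. A (fst q) \<bullet> snd q + Q (fst q)) has_derivative
     (\<lambda>v. A (fst q) \<bullet> snd v + frechet_derivative A (at (fst q)) (fst v) \<bullet> snd q
        + frechet_derivative Q (at (fst q)) (fst v))) (at q)"
    by (auto intro!: derivative_eq_intros)
  moreover have "(\<lambda>v. A (fst q) \<bullet> snd v + frechet_derivative A (at (fst q)) (fst v) \<bullet> snd q
        + frechet_derivative Q (at (fst q)) (fst v)) = (\<lambda>v. G q \<bullet> v)"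
    using fst_dom[OF assms]
    by (auto simp: DA DQ G_def inner_prod_def inner_vec_def[of "vec_lambda _"] inner_sum_left
        sum.distrib algebra_simps)
  ultimately show ?thesis
    by (simp add: F_def pairing_function_def case_prod_beta')
qed

lemma G_N: "q \<in> total_space \<Longrightarrow> G q \<bullet> N q = 1"
  using conormal_A[OF fst_dom] by (simp add: G_def N_def inner_prod_def inner_commute)

lemma G_has_derivative: "q \<in> total_space \<Longrightarrow> (G has_derivative frechet_derivative G (at q)) (at q)"
  by (rule smooth_on_has_derivative[OF smooth_G])

lemma frechet_G:
  assumes "q \<in> total_space"
  shows "frechet_derivative G (at q) v =
    ((\<chi> i. frechet_derivative (Ai i) (at (fst q)) (fst v) \<bullet> snd q + Ai i (fst q) \<bullet> snd v
        + frechet_derivative (Qi i) (at (fst q)) (fst v)),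
     frechet_derivative A (at (fst q)) (fst v))"
proof -
  note u = fst_dom[OF assms]
  have comp: "((\<lambda>q. f (fst q)) has_derivative (\<lambda>v. frechet_derivative f (at (fst q)) (fst v))) (at q)"
    if "smooth_on M f" for f :: "real^'n \<Rightarrow> 'z::real_normed_vector"
    by (rule has_derivative_compose[OF has_derivative_fst[OF has_derivative_ident]
      smooth_on_has_derivative[OF that u]])
  have "((\<lambda>q. Ai i (fst q) \<bullet> snd q + Qi i (fst q)) has_derivative
    (\<lambda>v. (Ai i (fst q) \<bullet> snd v + frechet_derivative (Ai i) (at (fst q)) (fst v) \<bullet> snd q)
        + frechet_derivative (Qi i) (at (fst q)) (fst v))) (at q)" for i
    by (intro has_derivative_add has_derivative_inner comp smooth_Ai smooth_Qi has_derivative_snd has_derivative_ident)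
  then have "((\<lambda>q. \<chi> i. Ai i (fst q) \<bullet> snd q + Qi i (fst q)) has_derivative
    (\<lambda>v. \<chi> i. (Ai i (fst q) \<bullet> snd v + frechet_derivative (Ai i) (at (fst q)) (fst v) \<bullet> snd q)
        + frechet_derivative (Qi i) (at (fst q)) (fst v))) (at q)"
    by (subst has_derivative_componentwise_within) (auto simp: Basis_vec_def inner_axis)
  then have "(G has_derivative (\<lambda>v. ((\<chi> i. (Ai i (fst q) \<bullet> snd v + frechet_derivative (Ai i) (at (fst q)) (fst v) \<bullet> snd q)
        + frechet_derivative (Qi i) (at (fst q)) (fst v)), frechet_derivative A (at (fst q)) (fst v)))) (at q)"
    unfolding G_def[abs_def] by (intro has_derivative_Pair comp smooth_A)
  from fun_cong[OF frechet_derivative_at[OF this], of v] show ?thesis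
    by (simp add: add.commute)
qed

text \<open>The fibre component of \<open>DG(v)\<close> is \<open>DA(v)\<close>, which the conormal
  kills. In the other slot, moving along the vertical vector \<open>N\<close> changes
  \<open>G\<close> only by the numbers \<open>A_i \<bullet> e\<close>, which are zero. The slots are
  treated separately, without appeal to symmetry of second derivatives.\<close>

lemma hess_N_right: "p \<in> total_space \<Longrightarrow> hess p v (N p) = 0"
  using conormal_DA[OF fst_dom]
  by (simp add: hess_def frechet_G N_def inner_prod_def inner_commute)

lemma hess_N_left: "p \<in> total_space \<Longrightarrow> hess p (N p) w = 0"
  by (simp add: hess_def frechet_G N_def inner_prod_def inner_vec_def[of "vec_lambda _"] DA fst_dom
      inner_commute[of "Ai _ _"] conormal_Ai
      frechet_zero[OF smooth_Ai] frechet_zero[OF smooth_Qi])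

lemma hess_scaleR_right: "hess p v (a *\<^sub>R w) = a * hess p v w"
  and hess_diff_right: "hess p v (w - w') = hess p v w - hess p v w'"
  by (simp_all add: hess_def inner_diff_right)


section \<open>Tangent spaces and second fundamental form of the level set\<close>

text \<open>A slide along the fibre: \<open>F\<close> is affine there and has slope 1 in the
  direction \<open>N\<close>, so a single step of length \<open>F q - c\<close> lands exactly on the
  level.\<close>

definition retr :: "(real^'n) \<times> (real^('n option)) \<Rightarrow> (real^'n) \<times> (real^('n option))" where
  "retr q = q - (F q - c) *\<^sub>R N q"

lemma F_eq: "F q = A (fst q) \<bullet> snd q + Q (fst q)"
  by (simp add: F_def pairing_function_def case_prod_beta')

lemma fst_retr: "fst (retr q) = fst q"
  by (simp add: retr_def N_def)

lemma retr_in_L: "q \<in> total_space \<Longrightarrow> retr q \<in> L"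
  using conormal_A[OF fst_dom, of q] fst_retr[of q]
  by (auto simp: L_def total_space_def F_eq retr_def N_def inner_diff_right inner_commute mem_Times_iff)

lemma retr_on_L: "q \<in> L \<Longrightarrow> retr q = q"
  by (simp add: L_def retr_def)

lemma smooth_retr: "smooth_on total_space retr"
  unfolding retr_def[abs_def]
  by (intro smooth_on_diff smooth_on_scaleR smooth_on_id smooth_F smooth_N smooth_on_const open_dom)

lemma L_dom: "p \<in> L \<Longrightarrow> p \<in> total_space"
  by (simp add: L_def)

lemma retr_has_derivative:
  assumes "p \<in> L"
  shows "(retr has_derivative (\<lambda>v. v - (G p \<bullet> v) *\<^sub>R N p)) (at p)"
proof -
  note p = L_dom[OF assms]
  \<comment> \<open>The derivative of \<open>N\<close> carries the factor \<open>F p - c\<close>,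
    zero on the level set; what remains is the projection along \<open>N\<close> onto the kernel of
    \<open>dF\<close>.\<close>
  have "(retr has_derivative (\<lambda>v. v - ((F p - c) *\<^sub>R frechet_derivative N (at p) v + (G p \<bullet> v - 0) *\<^sub>R N p))) (at p)"
    unfolding retr_def[abs_def]
    by (intro has_derivative_diff has_derivative_ident has_derivative_scaleR has_derivative_const
        F_has_derivative[OF p] smooth_on_has_derivative[OF smooth_N p])
  then show ?thesis using assms by (simp add: L_def)
qed

text \<open>A vector killed by \<open>dF\<close> is the velocity of the retracted line
  \<open>retr (p + t *\<^sub>R v)\<close>. The open set \<open>U\<close> is carried along because
  nondegeneracy and frames are defined on pieces of the hypersurface.\<close>

lemma tangent_space_L:
  assumes "open U" "p \<in> L \<inter> U"
  shows "tangent_space (L \<inter> U) p = {v. G p \<bullet> v = 0}"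
proof (intro equalityI subsetI)
  fix v assume "v \<in> tangent_space (L \<inter> U) p"
  then obtain \<gamma> e where e: "e > 0" and \<gamma>: "\<gamma> ` {-e<..<e} \<subseteq> L \<inter> U" "\<gamma> 0 = p"
      "(\<gamma> has_vector_derivative v) (at (0::real))"
    unfolding tangent_space_def mem_Collect_eq by (elim exE conjE) (rule that)
  have p: "p \<in> total_space" using assms L_dom by blast
  have "((\<lambda>t. F (\<gamma> t)) has_derivative (\<lambda>r. G p \<bullet> (r *\<^sub>R v))) (at 0)"
    using has_derivative_compose[OF \<gamma>(3)[unfolded has_vector_derivative_def], of F "\<lambda>v. G p \<bullet> v"]
      F_has_derivative[OF p] \<gamma>(2) by simp
  moreover have "((\<lambda>t. F (\<gamma> t)) has_derivative (\<lambda>r. 0)) (at 0)"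
  proof (rule has_derivative_transform_within_open[of "\<lambda>t. c"])
    show "c = F (\<gamma> t)" if "t \<in> {-e<..<e}" for t
      using that \<gamma>(1) unfolding L_def by blast
  qed (use e in auto)
  ultimately have "(\<lambda>r. G p \<bullet> (r *\<^sub>R v)) = (\<lambda>r. 0)"
    by (rule has_derivative_unique)
  from fun_cong[OF this, of 1] show "v \<in> {v. G p \<bullet> v = 0}" by simp
next
  fix v assume "v \<in> {v. G p \<bullet> v = 0}"
  then have v: "G p \<bullet> v = 0" by simp
  have pL: "p \<in> L" and pd: "p \<in> total_space" using assms L_dom by blast+
  define I where "I = (\<lambda>t::real. p + t *\<^sub>R v) -` total_space"
  define \<gamma> where "\<gamma> = (\<lambda>t. retr (p + t *\<^sub>R v))"
  have I: "open I"
    unfolding I_def by (intro open_vimage open_dom continuous_intros)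
  have sm: "smooth_on I \<gamma>"
    unfolding \<gamma>_def
    by (rule smooth_on_compose[OF I open_dom _ _ smooth_retr])
      (auto simp: I_def intro!: smooth_on_add smooth_on_const smooth_on_scaleR smooth_on_id I[unfolded I_def])
  have "open (I \<inter> \<gamma> -` U)"
    using continuous_on_open_vimage[OF I, of \<gamma>] smooth_on_continuous_on[OF sm] assms(1)
    by (metis Int_commute)
  moreover have \<gamma>0: "\<gamma> 0 = p" using retr_on_L[OF pL] by (simp add: \<gamma>_def)
  then have "0 \<in> I \<inter> \<gamma> -` U" using assms pd by (simp add: I_def)
  ultimately obtain e where e: "e > 0" "ball 0 e \<subseteq> I \<inter> \<gamma> -` U"
    unfolding open_contains_ball by blast
  then have sub: "{-e<..<e} \<subseteq> I \<inter> \<gamma> -` U"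
    by (simp add: ball_eq_greaterThanLessThan)
  have "((\<lambda>t. p + t *\<^sub>R v) has_derivative (\<lambda>t. 0 + t *\<^sub>R v)) (at 0)"
    by (intro has_derivative_add has_derivative_const has_derivative_scaleR_left has_derivative_ident)
  from has_derivative_compose[OF this, of retr "\<lambda>v. v - (G p \<bullet> v) *\<^sub>R N p"] retr_has_derivative[OF pL]
  have "(\<gamma> has_vector_derivative v) (at 0)"
    unfolding has_vector_derivative_def \<gamma>_def by (simp add: v)
  moreover have "\<gamma> ` {-e<..<e} \<subseteq> L \<inter> U"
  proof
    fix x assume "x \<in> \<gamma> ` {-e<..<e}"
    then obtain t where t: "t \<in> I" "\<gamma> t \<in> U" "x = \<gamma> t" using sub by blast
    then show "x \<in> L \<inter> U" using retr_in_L[of "p + t *\<^sub>R v"] by (simp add: I_def \<gamma>_def)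
  qed
  moreover have "smooth_on {-e<..<e} \<gamma>"
    using sub by (intro smooth_on_subset[OF sm]) blast
  ultimately show "v \<in> tangent_space (L \<inter> U) p"
    unfolding tangent_space_def mem_Collect_eq using e(1) \<gamma>0
    by (intro exI[of _ \<gamma>] exI[of _ e]) simp
qed

text \<open>The product rule for \<open>dF(Y)\<close>. For tangent \<open>Y\<close> it gives the
  second fundamental form; for a normal with \<open>dF(W)\<close> stationary it links
  \<open>Hess F(v, W)\<close> to \<open>\<tau>(v)\<close>.\<close>

lemma derivative_pairing:
  assumes "open U" "smooth_along (L \<inter> U) Y" "p \<in> L \<inter> U" "G p \<bullet> v = 0"
  shows "flat_deriv (L \<inter> U) (\<lambda>q. G q \<bullet> Y q) p v = hess p v (Y p) + G p \<bullet> flat_deriv (L \<inter> U) Y p v"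
proof -
  have p: "p \<in> total_space" using assms L_dom by blast
  have "((\<lambda>q. G q \<bullet> Y q) has_derivative
      (\<lambda>v. G p \<bullet> flat_deriv (L \<inter> U) Y p v + frechet_derivative G (at p) v \<bullet> Y p)) (at p within L \<inter> U)"
    by (rule has_derivative_inner[OF has_derivative_at_withinI[OF G_has_derivative[OF p]]
        smooth_along_has_derivative[OF assms(2,3)]])
  from flat_deriv_eq[OF this, of v] show ?thesis
    using tangent_space_L[OF assms(1,3)] assms(4) by (simp add: hess_def)
qed

lemma flat_deriv_locally_const:
  assumes "open U" "p \<in> L \<inter> U" "G p \<bullet> v = 0" "\<And>q. q \<in> L \<inter> U \<Longrightarrow> f q = k"
  shows "flat_deriv (L \<inter> U) f p v = 0"
proof -
  have "(f has_derivative (\<lambda>v. 0)) (at p within L \<inter> U)"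
    by (rule has_derivative_transform_within[of "\<lambda>q. k" _ _ _ 1]) (use assms in auto)
  from flat_deriv_eq[OF this, of v] show ?thesis
    using tangent_space_L[OF assms(1,2)] assms(3) by simp
qed

lemma hess_constant_pairing:
  assumes "open U" "smooth_along (L \<inter> U) Y" "p \<in> L \<inter> U" "G p \<bullet> v = 0"
    and "\<And>q. q \<in> L \<inter> U \<Longrightarrow> G q \<bullet> Y q = k"
  shows "G p \<bullet> flat_deriv (L \<inter> U) Y p v = - hess p v (Y p)"
  using derivative_pairing[OF assms(1-4)] flat_deriv_locally_const[OF assms(1,3,4,5)] by simp

lemma transversalD:
  assumes "open U" "transversal (L \<inter> U) T" "p \<in> L \<inter> U"
  shows "G p \<bullet> T p \<noteq> 0"
  using assms tangent_space_L[OF assms(1,3)] unfolding transversal_def by blast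

lemma transv_coeff_L:
  assumes "open U" "p \<in> L \<inter> U" "G p \<bullet> T p \<noteq> 0"
  shows "transv_coeff (L \<inter> U) T p w = (G p \<bullet> w) / (G p \<bullet> T p)"
  unfolding transv_coeff_def tangent_space_L[OF assms(1,2)]
  by (rule the_equality) (use assms(3) in \<open>auto simp: inner_diff_right field_simps\<close>)

lemma tangent_extension:
  assumes "p \<in> L" "G p \<bullet> w = 0"
  obtains Y where "smooth_on total_space Y" "\<And>q. q \<in> total_space \<Longrightarrow> G q \<bullet> Y q = 0" "Y p = w"
proof
  \<comment> \<open>The constant field \<open>w\<close>, projected along \<open>N\<close> to the
    kernel of \<open>dF\<close> at each point.\<close>
  show "smooth_on total_space (\<lambda>q. w - (G q \<bullet> w) *\<^sub>R N q)"
    by (intro smooth_on_diff smooth_on_const smooth_on_scaleR smooth_on_inner smooth_G smooth_N open_dom)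
qed (use assms G_N in \<open>auto simp: inner_diff_right\<close>)

text \<open>The definite description needs one extension of \<open>w\<close> and independence of the
  extension. Both come from the product rule with \<open>dF(Y) = 0\<close>: every extension, global
  or local, satisfies \<open>dF(D_v Y) = - Hess F(v, w)\<close>.\<close>

lemma second_form_L:
  assumes "open U" "p \<in> L \<inter> U" "G p \<bullet> T p \<noteq> 0" "G p \<bullet> v = 0" "G p \<bullet> w = 0"
  shows "second_form (L \<inter> U) T p v w = - hess p v w / (G p \<bullet> T p)"
  unfolding second_form_def
proof (rule the_equality)
  obtain Y where Y: "smooth_on total_space Y" "\<And>q. q \<in> total_space \<Longrightarrow> G q \<bullet> Y q = 0" "Y p = w"
    using tangent_extension assms by blast
  have sY: "smooth_along (L \<inter> U) Y"
    by (rule smooth_along_restrict[OF Y(1) open_dom]) (auto simp: L_def)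
  have "tangent_field (L \<inter> U) Y"
    unfolding tangent_field_def using sY tangent_space_L[OF assms(1)] Y(2) L_dom by auto
  moreover have "transv_coeff (L \<inter> U) T p (flat_deriv (L \<inter> U) Y p v) = - hess p v w / (G p \<bullet> T p)"
    using hess_constant_pairing[OF assms(1) sY assms(2,4), of 0] Y(2,3) L_dom
    by (simp add: transv_coeff_L[where T=T, OF assms(1-3)])
  ultimately show "\<exists>V Y. open V \<and> p \<in> V \<and> tangent_field (L \<inter> U \<inter> V) Y \<and> Y p = w \<and>
      - hess p v w / (G p \<bullet> T p) = transv_coeff (L \<inter> U) T p (flat_deriv (L \<inter> U) Y p v)"
    using Y(3) by (intro exI[of _ UNIV] exI[of _ Y]) auto
next
  fix k assume "\<exists>V Y. open V \<and> p \<in> V \<and> tangent_field (L \<inter> U \<inter> V) Y \<and> Y p = w \<and>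
      k = transv_coeff (L \<inter> U) T p (flat_deriv (L \<inter> U) Y p v)"
  then obtain V Y where V: "open V" "p \<in> V" and Y: "tangent_field (L \<inter> (U \<inter> V)) Y" "Y p = w"
    and k: "k = transv_coeff (L \<inter> U) T p (flat_deriv (L \<inter> U) Y p v)"
    unfolding Int_assoc by (elim exE conjE)
  have UV: "open (U \<inter> V)" "p \<in> L \<inter> (U \<inter> V)" using V assms(1,2) by auto
  have "G q \<bullet> Y q = 0" if "q \<in> L \<inter> (U \<inter> V)" for q
    using Y(1) that tangent_space_L[OF UV(1) that] unfolding tangent_field_def by blast
  moreover have "smooth_along (L \<inter> (U \<inter> V)) Y" using Y(1) unfolding tangent_field_def by blast
  ultimately have "G p \<bullet> flat_deriv (L \<inter> (U \<inter> V)) Y p v = - hess p v w"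
    using hess_constant_pairing[OF UV(1) _ UV(2) assms(4), of Y 0] Y(2) by blast
  moreover have "flat_deriv (L \<inter> (U \<inter> V)) Y p v = flat_deriv (L \<inter> U) Y p v"
    using flat_deriv_Int[OF V, of "L \<inter> U"] by (simp add: Int_assoc)
  ultimately show "k = - hess p v w / (G p \<bullet> T p)"
    by (simp add: k transv_coeff_L[where T=T, OF assms(1-3)])
qed

text \<open>Since \<open>\<kappa> \<noteq> 0\<close>, the vectors \<open>A\<close> and
  \<open>A_i\<close> form a basis at each point.\<close>

lemma fmat_kernel:
  assumes "u \<in> M" "\<And>i. Ai i u \<bullet> y = 0" "A u \<bullet> y = 0"
  shows "y = 0"
proof -
  have "fmat u (A u) *v y = 0"
    using assms(2,3) by (auto simp: vec_eq_iff matrix_vector_mul_component fmat_def split: option.split)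
  moreover have "invertible (fmat u (A u))"
    using det_fmat_A[OF assms(1)] kappa_nz by (simp add: invertible_det_nz)
  ultimately show ?thesis
    using matrix_left_invertible_ker invertible_left_inverse by blast
qed

text \<open>Because \<open>N\<close> is in the kernel of the second slot, orthogonality to tangent
  vectors extends to all vectors, so \<open>DG(v) = 0\<close>. Its fibre component and the immersion
  property give \<open>fst v = 0\<close>; its base component then says
  \<open>A_i \<bullet> snd v = 0\<close>, and tangency adds
  \<open>A \<bullet> snd v = 0\<close>.\<close>

lemma hess_nondegenerate:
  assumes "p \<in> total_space" "G p \<bullet> v = 0" "\<And>w. G p \<bullet> w = 0 \<Longrightarrow> hess p v w = 0"
  shows "v = 0"
proof -
  note u = fst_dom[OF assms(1)]
  have "hess p v w = 0" for w
  proof -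
    have "hess p v (w - (G p \<bullet> w) *\<^sub>R N p) = 0"
      by (rule assms(3)) (simp add: inner_diff_right G_N[OF assms(1)])
    then show ?thesis by (simp add: hess_diff_right hess_scaleR_right hess_N_right[OF assms(1)])
  qed
  then have "frechet_derivative G (at p) v \<bullet> frechet_derivative G (at p) v = 0"
    unfolding hess_def by blast
  then have z: "frechet_derivative G (at p) v = 0" by simp
  have lin: "linear (frechet_derivative A (at (fst p)))"
    by (rule linear_frechet_derivative[OF smooth_on_differentiable[OF smooth_A u]])
  have "inj (frechet_derivative A (at (fst p)))"
    using centroaffine u by (simp add: centroaffine_immersion_def)
  moreover have "frechet_derivative A (at (fst p)) (fst v) = 0"
    using arg_cong[OF z, of snd] by (simp add: frechet_G[OF assms(1)])
  ultimately have v1: "fst v = 0"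
    using linear_injective_0[OF lin] by blast
  have "Ai i (fst p) \<bullet> snd v = 0" for i
    using arg_cong[OF z, of "\<lambda>z. fst z $ i"]
    by (simp add: frechet_G[OF assms(1)] v1 frechet_zero[OF smooth_Ai u] frechet_zero[OF smooth_Qi u])
  moreover have "A (fst p) \<bullet> snd v = 0"
    using assms(2) by (simp add: G_def inner_prod_def v1)
  ultimately have "snd v = 0" by (rule fmat_kernel[OF u])
  with v1 show ?thesis by (simp add: prod_eq_iff)
qed

lemma nondegenerate_hypersurface_L: "nondegenerate_hypersurface L"
  unfolding nondegenerate_hypersurface_def
proof (intro conjI allI impI)
  show "smooth_hypersurface L"
    unfolding smooth_hypersurface_def
  proof
    fix p assume "p \<in> L"
    have "frechet_derivative (\<lambda>q. F q - c) (at q) (N q) \<noteq> 0" if "q \<in> total_space" for q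
    proof -
      have "((\<lambda>q. F q - c) has_derivative (\<lambda>v. G q \<bullet> v - 0)) (at q)"
        by (intro has_derivative_diff F_has_derivative that has_derivative_const)
      from fun_cong[OF frechet_derivative_at[OF this], of "N q"] show ?thesis
        using G_N[OF that] by simp
    qed
    then have "\<forall>q\<in>total_space. \<exists>v. frechet_derivative (\<lambda>q. F q - c) (at q) v \<noteq> 0"
      by blast
    moreover have "smooth_on total_space (\<lambda>q. F q - c)"
      by (intro smooth_on_diff smooth_F smooth_on_const open_dom)
    ultimately show "\<exists>U f. open U \<and> p \<in> U \<and> smooth_on U f \<and> L \<inter> U = {q \<in> U. f q = (0::real)} \<and>
        (\<forall>q\<in>U. \<exists>v. frechet_derivative f (at q) v \<noteq> 0)"
      using open_dom L_dom[OF \<open>p \<in> L\<close>]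
      by (intro exI[of _ total_space] exI[of _ "\<lambda>q. F q - c"] conjI)
        (simp_all add: L_def set_eq_iff conj_commute)
  qed
next
  fix U T assume UT: "open U \<and> transversal (L \<inter> U) T"
  show "nondegenerate_form (L \<inter> U) (second_form (L \<inter> U) T)"
    unfolding nondegenerate_form_def
  proof (intro ballI impI)
    fix p v assume p: "p \<in> L \<inter> U" and v: "v \<in> tangent_space (L \<inter> U) p"
      and 0: "\<forall>w\<in>tangent_space (L \<inter> U) p. second_form (L \<inter> U) T p v w = 0"
    note ts = tangent_space_L[OF conjunct1[OF UT] p]
    have G: "G p \<bullet> T p \<noteq> 0" using UT p transversalD by blast
    have v': "G p \<bullet> v = 0" using v unfolding ts by simp
    have "hess p v w = 0" if "G p \<bullet> w = 0" for w
    proof -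
      have "second_form (L \<inter> U) T p v w = 0" using 0 that unfolding ts by blast
      then show ?thesis using second_form_L[where T=T, OF conjunct1[OF UT] p G v' that] G by simp
    qed
    then show "v = 0" using hess_nondegenerate[of p v] p L_dom v' by blast
  qed
qed

end

section \<open>The ambient volume form in coordinates\<close>

definition coord_vec :: "(real^'n::finite) \<times> (real^('n option)) \<Rightarrow> real^('n + 'n) option" where
  "coord_vec v = (\<chi> s. ambient_coord v s)"

lemma coord_vec_inner: "coord_vec v \<bullet> coord_vec w = v \<bullet> w"
  by (simp add: coord_vec_def inner_vec_def inner_prod_def sum_UNIV_option sum_UNIV_sum ambient_coord_def)

lemma linear_ambient_coord: "linear (\<lambda>v. ambient_coord v s)"
  by (rule linearI) (auto simp: ambient_coord_def split: option.split sum.split)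

lemma linear_coord_vec: "linear coord_vec"
  by (rule linearI) (auto simp: coord_vec_def vec_eq_iff linear_add[OF linear_ambient_coord]
      linear_scale[OF linear_ambient_coord])

lemma coord_vec_scaleR: "coord_vec (a *\<^sub>R v) = a *s coord_vec v"
  by (simp add: linear_scale[OF linear_coord_vec] scalar_mult_eq_scaleR)

lemma coord_vec_eq_0_iff: "coord_vec v = 0 \<longleftrightarrow> v = 0"
  using coord_vec_inner[of v v] by (metis inner_eq_zero_iff)

lemma Upsilon_form_coord_vec: "Upsilon_form X = (-1) ^ CARD('n) * det (\<chi> r. coord_vec (X r))"
  for X :: "('n::finite + 'n) option \<Rightarrow> _"
  by (simp add: Upsilon_form_def coord_vec_def)

lemma abs_Upsilon_form: "\<bar>Upsilon_form X\<bar> = \<bar>det (\<chi> r. coord_vec (X r))\<bar>"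
  by (simp add: Upsilon_form_coord_vec abs_mult power_abs)

text \<open>Jacobi's formula: if the frame moves by the matrix \<open>\<Theta>\<close>, its volume changes at the rate \<open>tr \<Theta>\<close>.\<close>

lemma Upsilon_has_derivative:
  fixes T :: "'b::real_normed_vector \<Rightarrow> (real^'n::finite) \<times> (real^('n option))"
    and E :: "'n + 'n \<Rightarrow> 'b \<Rightarrow> (real^'n) \<times> (real^('n option))"
  assumes T: "(T has_derivative T') (at p within S)"
    and E: "\<And>i. (E i has_derivative E' i) (at p within S)"
  obtains D where "((\<lambda>q. Upsilon_form (case_option (T q) (\<lambda>i. E i q))) has_derivative D) (at p within S)"
    and "\<And>v \<tau> s t \<theta>. T' v = \<tau> *\<^sub>R T p + (\<Sum>i\<in>UNIV. s i *\<^sub>R E i p) \<Longrightarrow>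
      (\<And>j. E' j v = t j *\<^sub>R T p + (\<Sum>i\<in>UNIV. \<theta> i j *\<^sub>R E i p)) \<Longrightarrow>
      D v = (\<tau> + (\<Sum>i\<in>UNIV. \<theta> i i)) * Upsilon_form (case_option (T p) (\<lambda>i. E i p))"
proof -
  define V where "V q r = case_option (T q) (\<lambda>i. E i q) r" for q r
  define V' where "V' r v = case_option (T' v) (\<lambda>i. E' i v) r" for r v
  have V: "((\<lambda>q. V q r) has_derivative V' r) (at p within S)" for r
    unfolding V_def V'_def by (cases r) (simp_all add: T E eta_contract_eq)
  have "((\<lambda>q. ambient_coord (V q r) s) has_derivative (\<lambda>v. ambient_coord (V' r v) s)) (at p within S)" for r s
    by (rule bounded_linear.has_derivative[OF linear_conv_bounded_linear[THEN iffD1, OF linear_ambient_coord] V])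
  from has_derivative_det[of "\<lambda>r s q. ambient_coord (V q r) s", OF this]
  have "((\<lambda>q. (-1) ^ CARD('n) * det (\<chi> r. coord_vec (V q r))) has_derivative
      (\<lambda>v. (-1) ^ CARD('n) * (\<Sum>k\<in>UNIV. det (\<chi> r. if r = k then coord_vec (V' k v) else coord_vec (V p r)))))
      (at p within S)"
    unfolding coord_vec_def by (rule has_derivative_mult_right)
  then have "((\<lambda>q. Upsilon_form (case_option (T q) (\<lambda>i. E i q))) has_derivative
      (\<lambda>v. (-1) ^ CARD('n) * (\<Sum>k\<in>UNIV. det (\<chi> r. if r = k then coord_vec (V' k v) else coord_vec (V p r)))))
      (at p within S)"
    unfolding Upsilon_form_coord_vec V_def .
  moreover have "(-1) ^ CARD('n) * (\<Sum>k\<in>UNIV. det (\<chi> r. if r = k then coord_vec (V' k v) else coord_vec (V p r)))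
      = (\<tau> + (\<Sum>i\<in>UNIV. \<theta> i i)) * Upsilon_form (case_option (T p) (\<lambda>i. E i p))"
    if 1: "T' v = \<tau> *\<^sub>R T p + (\<Sum>i\<in>UNIV. s i *\<^sub>R E i p)"
      and 2: "\<And>j. E' j v = t j *\<^sub>R T p + (\<Sum>i\<in>UNIV. \<theta> i j *\<^sub>R E i p)" for v \<tau> s t \<theta>
  proof -
    \<comment> \<open>The derivative of the frame \<open>(T, E)\<close> expressed in the frame
      itself, with one row per frame vector, so \<open>\<theta>\<close> enters transposed. The
      entries \<open>s\<close> and \<open>t\<close> lie off the diagonal and drop out of the
      trace.\<close>
    define \<Theta> where "\<Theta> k l = (case k of None \<Rightarrow> case_option \<tau> s l | Some j \<Rightarrow> case_option (t j) (\<lambda>i. \<theta> i j) l)" for k l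
    define B where "B = (\<chi> r. coord_vec (V p r))"
    have "V' k v = (\<Sum>l\<in>UNIV. \<Theta> k l *\<^sub>R V p l)" for k
      by (cases k) (simp_all add: V'_def V_def \<Theta>_def sum_UNIV_option 1 2)
    then have "coord_vec (V' k v) = (\<Sum>l\<in>UNIV. \<Theta> k l *s (B $ l))" for k
      by (simp add: linear_sum[OF linear_coord_vec] coord_vec_scaleR B_def)
    then have "(\<Sum>k\<in>UNIV. det (\<chi> r. if r = k then coord_vec (V' k v) else coord_vec (V p r)))
       = (\<Sum>k\<in>UNIV. det (\<chi> r. if r = k then (\<Sum>l\<in>UNIV. \<Theta> k l *s (B $ l)) else B $ r))"
      by (simp add: B_def cong: if_cong)
    also have "\<dots> = (\<Sum>k\<in>UNIV. \<Theta> k k) * det B"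
      by (simp add: det_replace_row_combination sum_distrib_right)
    also have "(\<Sum>k\<in>UNIV. \<Theta> k k) = \<tau> + (\<Sum>i\<in>UNIV. \<theta> i i)"
      by (simp add: sum_UNIV_option \<Theta>_def)
    finally show ?thesis
      by (simp add: Upsilon_form_coord_vec B_def V_def)
  qed
  ultimately show thesis by (rule that)
qed

lemma has_derivative_abs_nonzero:
  fixes f :: "'b::real_normed_vector \<Rightarrow> real"
  assumes f: "(f has_derivative D) (at p within S)" and "p \<in> S" "f p \<noteq> 0"
  shows "((\<lambda>q. \<bar>f q\<bar>) has_derivative (\<lambda>v. sgn (f p) * D v)) (at p within S)"
proof -
  have "((\<lambda>y. \<bar>y\<bar>) has_derivative (\<lambda>h. sgn (f p) * h)) (at (f p))"
  proof (rule has_derivative_transform_within_open[of "\<lambda>y. sgn (f p) * y"])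
    show "((\<lambda>y. sgn (f p) * y) has_derivative (\<lambda>h. sgn (f p) * h)) (at (f p))"
      by (intro has_derivative_mult_right has_derivative_ident)
    show "open (ball (f p) \<bar>f p\<bar>)" by simp
    show "f p \<in> ball (f p) \<bar>f p\<bar>" using assms by simp
    show "sgn (f p) * y = \<bar>y\<bar>" if "y \<in> ball (f p) \<bar>f p\<bar>" for y
      using that by (auto simp: dist_real_def sgn_if abs_if split: if_splits)
  qed
  from has_derivative_compose[OF f this] show ?thesis .
qed

section \<open>Volume and Hessian determinant\<close>

context pairing_data begin

text \<open>All rows are orthogonal to the coordinate vector of \<open>G p\<close>, which is nonzero
  because \<open>dF(N) = 1\<close>.\<close>

lemma det_coord_vec_tangent:
  fixes Y :: "('n + 'n) option \<Rightarrow> (real^'n) \<times> (real^('n option))"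
  assumes "p \<in> total_space" "\<And>r. G p \<bullet> Y r = 0"
  shows "det (\<chi> r. coord_vec (Y r)) = 0"
proof (rule ccontr)
  assume "det (\<chi> r. coord_vec (Y r)) \<noteq> 0"
  then have "invertible (\<chi> r. coord_vec (Y r))" by (simp add: invertible_det_nz)
  moreover have "(\<chi> r. coord_vec (Y r)) *v coord_vec (G p) = 0"
    using assms(2) by (simp add: vec_eq_iff matrix_vector_mul_component coord_vec_inner inner_commute)
  ultimately have "coord_vec (G p) = 0"
    using matrix_left_invertible_ker invertible_left_inverse by blast
  then show False using G_N[OF assms(1)] by (simp add: coord_vec_eq_0_iff)
qed

text \<open>Split \<open>w\<close> into \<open>dF(w) N\<close> and a tangent vector; by the
  preceding lemma the tangent part contributes nothing.\<close>

lemma abs_Upsilon_transversal: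
  assumes "p \<in> total_space" "\<And>i. G p \<bullet> X i = 0"
  shows "\<bar>Upsilon_form (case_option w X)\<bar> = \<bar>G p \<bullet> w\<bar> * \<bar>Upsilon_form (case_option (N p) X)\<bar>"
proof -
  define b where "b r = coord_vec (case_option 0 X r)" for r
  have b: "(\<chi> r. coord_vec (case_option y X r)) = (\<chi> r. if r = None then coord_vec y else b r)" for y
    by (auto simp: vec_eq_iff b_def split: option.split)
  define w0 where "w0 = w - (G p \<bullet> w) *\<^sub>R N p"
  have cw: "coord_vec w = (G p \<bullet> w) *s coord_vec (N p) + coord_vec w0"
    by (simp add: w0_def coord_vec_scaleR[symmetric] linear_diff[OF linear_coord_vec])
  have "det (\<chi> r. if r = None then coord_vec w else b r)
     = (G p \<bullet> w) * det (\<chi> r. if r = None then coord_vec (N p) else b r)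
       + det (\<chi> r. if r = None then coord_vec w0 else b r)"
    unfolding cw
    using det_row_add[of None "\<lambda>_. (G p \<bullet> w) *s coord_vec (N p)" "\<lambda>_. coord_vec w0" b]
      det_row_mul[of None "G p \<bullet> w" "\<lambda>_. coord_vec (N p)" b] by simp
  moreover have "det (\<chi> r. if r = None then coord_vec w0 else b r) = 0"
    unfolding b[symmetric]
  proof (rule det_coord_vec_tangent[OF assms(1)])
    show "G p \<bullet> case_option w0 X r = 0" for r
      using assms by (cases r) (simp_all add: w0_def inner_diff_right G_N)
  qed
  ultimately show ?thesis
    by (simp add: abs_Upsilon_form b abs_mult)
qed

text \<open>The covectors \<open>dF\<close>, \<open>du^i\<close> and \<open>A_i\<close> on the
  fibre, written as vectors through the inner product. In terms of the last two families the Hessian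
  is \<open>H_ij du^i du^j + A_j du^j + du^i A_i\<close>, which dictates the choice.\<close>

definition dual_frame :: "(real^'n) \<times> (real^('n option)) \<Rightarrow> ('n + 'n) option \<Rightarrow> (real^'n) \<times> (real^('n option))" where
  "dual_frame p t = (case t of None \<Rightarrow> G p | Some (Inl i) \<Rightarrow> (axis i 1, 0) | Some (Inr i) \<Rightarrow> (0, Ai i (fst p)))"

text \<open>\<open>G\<close> differs from \<open>(0, A)\<close> by a combination of the rows
  \<open>du^i\<close>. After this row operation there remain an identity block and the rows
  \<open>A, A_1, ..., A_n\<close>, whose determinant is \<open>\<kappa>\<close>.\<close>

lemma det_dual_frame:
  assumes "p \<in> total_space"
  shows "det (\<chi> t. coord_vec (dual_frame p t)) = \<kappa>"
proof -
  let ?u = "fst p"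
  define f :: "'n option \<Rightarrow> ('n + 'n) option" where "f = map_option Inr"
  have inj: "inj f" unfolding f_def by (rule option.inj_map) simp
  have f: "f None = None" "f (Some i) = Some (Inr i)" for i by (simp_all add: f_def)
  have inv: "inv f None = None" "inv f (Some (Inr i)) = Some i" for i
    using inv_f_f[OF inj] f by metis+
  have ran: "None \<in> range f" "Some (Inr i) \<in> range f" "Some (Inl i) \<notin> range f" for i
    using f by (metis rangeI, metis rangeI, auto simp: f_def map_option_case split: option.splits)
  define B :: "real^('n + 'n) option^('n + 'n) option" where
    "B = (\<chi> t. coord_vec (case t of None \<Rightarrow> (0, A ?u) | Some (Inl i) \<Rightarrow> (axis i 1, 0) | Some (Inr i) \<Rightarrow> (0, Ai i ?u)))"
  have "B = embed_mat f (fmat ?u (A ?u))"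
    by (simp add: vec_eq_iff split_option_all split_sum_all B_def coord_vec_def embed_mat_def inv ran
        fmat_def ambient_coord_def axis_def)
  then have "det B = \<kappa>"
    using det_embed_mat[OF inj] det_fmat_A[OF fst_dom[OF assms]] by simp
  moreover define x where "x = (\<Sum>i\<in>UNIV. fst (G p) $ i *s row (Some (Inl i)) B)"
  have "x \<in> vec.span {row j B |j. j \<noteq> None}"
    unfolding x_def by (intro vec.span_sum vec.span_scale vec.span_base) blast
  from det_row_span[OF this] have "det (\<chi> k. if k = None then row None B + x else row k B) = det B" .
  moreover have "(\<chi> k. if k = None then row None B + x else row k B) = (\<chi> t. coord_vec (dual_frame p t))"
  proof -
    have "x = coord_vec (\<Sum>i\<in>UNIV. fst (G p) $ i *\<^sub>R (axis i 1, 0))"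
      by (simp only: linear_sum[OF linear_coord_vec] coord_vec_scaleR) (simp add: x_def row_def B_def)
    also have "(\<Sum>i\<in>UNIV. fst (G p) $ i *\<^sub>R (axis i 1, 0 :: real^('n option))) = (fst (G p), 0)"
      by (simp add: prod_eq_iff fst_sum snd_sum vec_eq_iff axis_def if_distrib sum.delta cong: if_cong)
    finally have "row None B + x = coord_vec (G p)"
      by (simp add: B_def row_def linear_add[OF linear_coord_vec, symmetric] G_def)
    then show ?thesis
      by (auto simp: vec_eq_iff dual_frame_def B_def row_def split: option.split sum.split)
  qed
  ultimately show ?thesis by simp
qed

text \<open>The only part of the Hessian that contains second derivatives of \<open>A\<close> and
  \<open>Q\<close>. It drops out of the determinant, since the block below it in \<open>Xi\<close>
  is the identity and the diagonal block opposite is zero.\<close>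

definition hess_block :: "(real^'n) \<times> (real^('n option)) \<Rightarrow> 'n \<Rightarrow> 'n \<Rightarrow> real" where
  "hess_block p i j = frechet_derivative (Ai j) (at (fst p)) (axis i 1) \<bullet> snd p
      + frechet_derivative (Qi j) (at (fst p)) (axis i 1)"

lemma hess_coordinates:
  assumes "p \<in> total_space"
  shows "hess p v w = (\<Sum>j\<in>UNIV. ((\<Sum>i\<in>UNIV. fst v $ i * hess_block p i j) + Ai j (fst p) \<bullet> snd v) * fst w $ j)
      + (\<Sum>i\<in>UNIV. fst v $ i * (Ai i (fst p) \<bullet> snd w))"
proof -
  note u = fst_dom[OF assms]
  have "frechet_derivative (Ai j) (at (fst p)) (fst v) \<bullet> snd p + frechet_derivative (Qi j) (at (fst p)) (fst v)
      = (\<Sum>i\<in>UNIV. fst v $ i * hess_block p i j)" for j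
    unfolding hess_block_def
    by (subst frechet_coordinates[OF smooth_on_differentiable[OF smooth_Ai u]],
        subst frechet_coordinates[OF smooth_on_differentiable[OF smooth_Qi u]])
      (simp add: inner_sum_left sum.distrib algebra_simps)
  then show ?thesis
    by (simp add: hess_def frechet_G[OF assms] inner_prod_def inner_vec_def[of "vec_lambda _"] DA[OF u]
        inner_sum_left algebra_simps)
qed

text \<open>With \<open>K = Hess F + dF \<otimes> dF\<close>, the Gram matrix of \<open>K\<close> on \<open>(N, X)\<close> is block diagonal, whereas in
  the frame dual to \<open>dual_frame\<close> the form \<open>K\<close> has determinant \<open>\<plusminus> 1\<close>.\<close>

lemma Upsilon_hess:
  assumes "p \<in> total_space" "\<And>i. G p \<bullet> X i = 0"
  shows "\<kappa>\<^sup>2 * (Upsilon_form (case_option (N p) X))\<^sup>2 = \<bar>det (\<chi> i j. hess p (X i) (X j))\<bar>"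
proof -
  define V where "V = case_option (N p) X"
  define Vm where "Vm = (\<chi> r. coord_vec (V r))"
  define J where "J = (\<chi> t. coord_vec (dual_frame p t))"
  define Xi :: "real^('n + 'n) option^('n + 'n) option" where
    "Xi = (\<chi> r s. case r of None \<Rightarrow> of_bool (s = None)
     | Some (Inl i) \<Rightarrow> (case s of None \<Rightarrow> 0 | Some (Inl j) \<Rightarrow> hess_block p i j | Some (Inr j) \<Rightarrow> of_bool (i = j))
     | Some (Inr i) \<Rightarrow> of_bool (s = Some (Inl i)))"
  \<comment> \<open>The coframe evaluated on the frame \<open>(N, X)\<close>. Then
    \<open>W Xi W^T\<close> is the Gram matrix of \<open>K\<close>, while \<open>det W\<close> is
    the volume of the frame, up to sign, times \<open>\<kappa>\<close>; this is where
    \<open>\<kappa>\<close> squared comes from.\<close>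
  define W where "W = Vm ** transpose J"
  have W: "W $ r $ t = V r \<bullet> dual_frame p t" for r t
    by (simp add: W_def matrix_matrix_mult_def transpose_def Vm_def J_def coord_vec_inner[symmetric] inner_vec_def)
  have "(W ** Xi ** transpose W) $ r $ s = hess p (V r) (V s) + (G p \<bullet> V r) * (G p \<bullet> V s)" for r s
  proof -
    have "(W ** Xi ** transpose W) $ r $ s = (\<Sum>t\<in>UNIV. (\<Sum>t'\<in>UNIV. W $ r $ t' * Xi $ t' $ t) * W $ s $ t)"
      by (simp add: matrix_matrix_mult_def transpose_def)
    also have "\<dots> = W $ r $ None * W $ s $ None
       + ((\<Sum>j\<in>UNIV. ((\<Sum>i\<in>UNIV. W $ r $ Some (Inl i) * hess_block p i j) + W $ r $ Some (Inr j)) * W $ s $ Some (Inl j))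
       + (\<Sum>j\<in>UNIV. W $ r $ Some (Inl j) * W $ s $ Some (Inr j)))"
      by (simp add: sum_UNIV_option sum_UNIV_sum Xi_def of_bool_def if_distrib[of "\<lambda>x. _ * x"] sum.delta sum.delta' cong: if_cong)
    also have "\<dots> = hess p (V r) (V s) + (G p \<bullet> V r) * (G p \<bullet> V s)"
      by (simp add: W dual_frame_def hess_coordinates[OF assms(1)] inner_prod_def[of _ "(_, _)"] inner_axis inner_axis')
         (simp add: inner_commute)
    finally show ?thesis .
  qed
  \<comment> \<open>\<open>Hess F\<close> vanishes on \<open>N\<close> in either slot,
    \<open>dF\<close> vanishes on \<open>X\<close> and \<open>dF(N) = 1\<close>, so the
    \<open>None\<close> row and column are those of the identity.\<close>
  then have gram: "W ** Xi ** transpose W = embed_mat Some (\<chi> i j. hess p (X i) (X j))"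
    using assms G_N[OF assms(1)]
    by (simp add: vec_eq_iff split_option_all embed_mat_def V_def hess_N_left hess_N_right image_iff
        inv_f_f[of Some])
  have "det (W ** Xi ** transpose W) = det (\<chi> i j. hess p (X i) (X j))"
    unfolding gram by (rule det_embed_mat) simp
  then have "\<bar>det (\<chi> i j. hess p (X i) (X j))\<bar> = \<bar>det W\<bar> * \<bar>det Xi\<bar> * \<bar>det W\<bar>"
    by (simp add: det_mul abs_mult[symmetric])
  moreover have "\<bar>det Xi\<bar> = 1"
    unfolding Xi_def by (rule abs_det_antidiagonal_block)
  moreover have "\<bar>det W\<bar> = \<bar>Upsilon_form V\<bar> * \<bar>\<kappa>\<bar>"
    by (simp add: W_def det_mul J_def det_dual_frame[OF assms(1)] abs_mult abs_Upsilon_form Vm_def)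
  ultimately have "\<bar>det (\<chi> i j. hess p (X i) (X j))\<bar> = (\<bar>Upsilon_form V\<bar> * \<bar>\<kappa>\<bar>)\<^sup>2"
    by (simp add: power2_eq_square)
  then show ?thesis
    by (simp add: power_mult_distrib V_def mult.commute)
qed

end

section \<open>Independent families and their coefficients\<close>

lemma independent_familyD:
  fixes f :: "'i::finite \<Rightarrow> 'v::euclidean_space"
  assumes "inj f" "independent (range f)" "(\<Sum>i\<in>UNIV. c i *\<^sub>R f i) = 0"
  shows "c i = 0"
proof -
  have "(\<Sum>v\<in>range f. c (inv f v) *\<^sub>R v) = 0"
    using assms(1,3) by (simp add: sum.reindex)
  with independentD[OF assms(2) finite_imageI[OF finite] order_refl, of "\<lambda>v. c (inv f v)" "f i"]
  show ?thesis using assms(1) by simp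
qed

lemma independent_familyI:
  fixes f :: "'i::finite \<Rightarrow> 'v::euclidean_space"
  assumes "\<And>c i. (\<Sum>i\<in>UNIV. c i *\<^sub>R f i) = 0 \<Longrightarrow> c i = 0"
  shows "inj f" "independent (range f)"
proof -
  show inj: "inj f"
  proof (rule injI, rule ccontr)
    fix i j assume ij: "f i = f j" "i \<noteq> j"
    have "(\<Sum>k\<in>UNIV. (of_bool (k = i) - of_bool (k = j)) *\<^sub>R f k) = f i - f j"
      by (simp add: scaleR_diff_left sum_subtractf of_bool_def if_distrib[of "\<lambda>x. x *\<^sub>R _"] cong: if_cong)
    from assms[of "\<lambda>k. of_bool (k = i) - of_bool (k = j)" i] this ij show False by simp
  qed
  have "finite (range f)" by simp
  moreover have "u v = 0" if "(\<Sum>v\<in>range f. u v *\<^sub>R v) = 0" "v \<in> range f" for u v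
    using assms[of "\<lambda>i. u (f i)"] that inj by (auto simp: sum.reindex)
  ultimately show "independent (range f)"
    by (rule independent_if_scalars_zero)
qed

lemma span_familyE:
  fixes f :: "'i::finite \<Rightarrow> 'v::euclidean_space"
  assumes "inj f" "x \<in> span (range f)"
  obtains c where "x = (\<Sum>i\<in>UNIV. c i *\<^sub>R f i)"
proof -
  obtain u where "x = (\<Sum>v\<in>range f. u v *\<^sub>R v)"
    using assms(2) span_finite[OF finite_imageI[OF finite], of f UNIV] by auto
  then have "x = (\<Sum>i\<in>UNIV. u (f i) *\<^sub>R f i)"
    using assms(1) by (simp add: sum.reindex)
  then show thesis by (rule that)
qed

section \<open>Tangent frames and induced densities\<close>

context pairing_data begin

lemma dim_tangent:
  assumes "p \<in> total_space"
  shows "dim {v. G p \<bullet> v = 0} = CARD('n + 'n)"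
proof -
  have "G p \<noteq> 0" using G_N[OF assms] by auto
  then show ?thesis by (simp add: dim_hyperplane)
qed

text \<open>A basis of the tangent space at \<open>p\<close> is projected along \<open>N\<close> to
  nearby points. A relation at \<open>q\<close> would put a multiple of \<open>N q\<close> into the
  tangent space at \<open>p\<close>, so independence holds where
  \<open>dF_p(N q) \<noteq> 0\<close>; this defines \<open>U\<close>.\<close>

lemma tangent_frame_exists:
  assumes "p \<in> L"
  obtains U and E :: "'n + 'n \<Rightarrow> _" where "open U" "p \<in> U" "tangent_frame (L \<inter> U) E"
proof -
  have p: "p \<in> total_space" using assms by (rule L_dom)
  obtain B where B: "B \<subseteq> {v. G p \<bullet> v = 0}" "independent B" "card B = CARD('n + 'n)"
    using basis_exists[of "{v. G p \<bullet> v = 0}"] dim_tangent[OF p] by metis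
  have finB: "finite B" using B(2) by (rule independent_imp_finite)
  obtain w where w: "bij_betw w (UNIV :: ('n + 'n) set) B"
    using finite_same_card_bij[OF finite finB] B(3) by metis
  then have winj: "inj w" and wran: "range w = B" by (simp_all add: bij_betw_def)
  define U where "U = (\<lambda>q. G p \<bullet> N q) -` (- {0}) \<inter> total_space"
  define E where "E = (\<lambda>i q. w i - (G q \<bullet> w i) *\<^sub>R N q)"
  have "continuous_on total_space (\<lambda>q. G p \<bullet> N q)"
    by (intro continuous_intros smooth_on_continuous_on[OF smooth_N])
  then have U: "open U"
    unfolding U_def using continuous_on_open_vimage[OF open_dom] by blast
  have smooth_E: "smooth_on total_space (E i)" for i
    unfolding E_def
    by (intro smooth_on_diff smooth_on_const smooth_on_scaleR smooth_on_inner smooth_G smooth_N open_dom)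
  have "tangent_frame (L \<inter> U) E"
    unfolding tangent_frame_def
  proof (intro conjI allI ballI)
    fix i
    show "tangent_field (L \<inter> U) (E i)"
      unfolding tangent_field_def
    proof (intro conjI ballI)
      show "smooth_along (L \<inter> U) (E i)"
        by (rule smooth_along_restrict[OF smooth_E open_dom]) (auto simp: L_def)
      show "E i q \<in> tangent_space (L \<inter> U) q" if q: "q \<in> L \<inter> U" for q
        unfolding tangent_space_L[OF U q] using G_N[of q] q
        by (simp add: E_def inner_diff_right L_def)
    qed
  next
    fix q assume q: "q \<in> L \<inter> U"
    then have qd: "q \<in> total_space" by (simp add: L_def)
    have ind: "c i = 0" if "(\<Sum>i\<in>UNIV. c i *\<^sub>R E i q) = 0" for c i
    proof -
      define y where "y = (\<Sum>i\<in>UNIV. c i *\<^sub>R w i)"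
      have "(\<Sum>i\<in>UNIV. c i *\<^sub>R E i q) = y - (G q \<bullet> y) *\<^sub>R N q"
        by (simp add: E_def y_def scaleR_diff_right sum_subtractf scaleR_sum_left inner_sum_right)
      then have y: "y = (G q \<bullet> y) *\<^sub>R N q" using that by simp
      have "G p \<bullet> w i = 0" for i using B(1) wran by blast
      then have "G p \<bullet> y = 0" by (simp add: y_def inner_sum_right)
      then have "(G q \<bullet> y) * (G p \<bullet> N q) = 0" using y by (metis inner_scaleR_right)
      then have "G q \<bullet> y = 0" using q by (simp add: U_def)
      then have "y = 0" using y by simp
      then show ?thesis
        using independent_familyD[OF winj, of c i] B(2) wran by (simp add: y_def)
    qed
    show inj: "inj (\<lambda>i. E i q)" and indep: "independent (range (\<lambda>i. E i q))"
      using independent_familyI[of "\<lambda>i. E i q"] ind by blast+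
    have "range (\<lambda>i. E i q) \<subseteq> {v. G q \<bullet> v = 0}"
      using G_N[OF qd] by (auto simp: E_def inner_diff_right)
    moreover have sub: "subspace {v. G q \<bullet> v = 0}" by (rule subspace_hyperplane)
    ultimately have "span (range (\<lambda>i. E i q)) \<subseteq> {v. G q \<bullet> v = 0}" by (rule span_minimal)
    moreover have "dim (span (range (\<lambda>i. E i q))) = CARD('n + 'n)"
      using card_image[OF inj] by (simp only: dim_span_eq_card_independent[OF indep])
    ultimately show "span (range (\<lambda>i. E i q)) = tangent_space (L \<inter> U) q"
      unfolding tangent_space_L[OF U q]
      by (intro subspace_dim_equal subspace_span sub) (simp_all add: dim_tangent[OF qd])
  qed
  moreover have "p \<in> U" using p G_N by (simp add: U_def)
  ultimately show thesis using U that by blast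
qed

text \<open>Pairing a linear relation with \<open>dF\<close> isolates the coefficient of
  \<open>N\<close>, and the rest is a relation in the tangent frame.\<close>

lemma Upsilon_frame_nonzero:
  assumes "p \<in> total_space" "\<And>i. G p \<bullet> X i = 0" "inj X" "independent (range X)"
  shows "Upsilon_form (case_option (N p) X) \<noteq> 0"
proof
  define V where "V = case_option (N p) X"
  define B where "B = (\<chi> r. coord_vec (V r))"
  assume "Upsilon_form (case_option (N p) X) = 0"
  then have "det (transpose B) = 0"
    using abs_Upsilon_form[of V] by (simp add: V_def B_def)
  then obtain x where x: "transpose B *v x = 0" "x \<noteq> 0"
    by (metis invertible_det_nz invertible_left_inverse matrix_left_invertible_ker)
  have "coord_vec (\<Sum>r\<in>UNIV. x $ r *\<^sub>R V r) = transpose B *v x"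
    by (simp add: linear_sum[OF linear_coord_vec] coord_vec_scaleR matrix_mult_sum column_transpose row_def B_def)
  then have 0: "(\<Sum>r\<in>UNIV. x $ r *\<^sub>R V r) = 0" using x by (simp add: coord_vec_eq_0_iff)
  have "x $ None = G p \<bullet> (\<Sum>r\<in>UNIV. x $ r *\<^sub>R V r)"
    using assms(1,2) by (simp add: sum_UNIV_option V_def inner_add_right inner_sum_right G_N)
  then have n: "x $ None = 0" by (simp add: 0)
  then have "(\<Sum>i\<in>UNIV. x $ Some i *\<^sub>R X i) = 0" using 0 by (simp add: sum_UNIV_option V_def)
  then have "x $ Some i = 0" for i by (rule independent_familyD[OF assms(3,4)])
  with n have "x = 0" by (simp add: vec_eq_iff split_option_all)
  with x show False by blast
qed

lemmas tangent_space_L' = tangent_space_L[of UNIV, simplified]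
lemmas derivative_pairing' = derivative_pairing[of UNIV, simplified]
lemmas flat_deriv_locally_const' = flat_deriv_locally_const[of UNIV, simplified]
lemmas transversalD' = transversalD[of UNIV, simplified]
lemmas transv_coeff_L' = transv_coeff_L[of UNIV, simplified]
lemmas second_form_L' = second_form_L[of UNIV, simplified]

lemma tangent_frameD:
  assumes "tangent_frame (L \<inter> U) E" "open U" "p \<in> L \<inter> U"
  shows "smooth_along (L \<inter> U) (E i)" "G p \<bullet> E i p = 0" "inj (\<lambda>i. E i p)"
    "independent (range (\<lambda>i. E i p))" "span (range (\<lambda>i. E i p)) = {v. G p \<bullet> v = 0}"
  using assms(1,3) tangent_space_L[OF assms(2,3)] unfolding tangent_frame_def tangent_field_def by auto

text \<open>Jacobi's formula for the frame \<open>(W, E)\<close>: the diagonal coefficients are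
  \<open>\<tau>(v) = dF(D_v W) / dF(W)\<close> for \<open>W\<close> and those of
  \<open>\<theta>\<close> for \<open>E\<close>. As the density is positive on a frame, it is
  parallel only if \<open>\<tau>\<close> vanishes.\<close>

lemma flat_deriv_density:
  fixes E :: "'n + 'n \<Rightarrow> (real^'n) \<times> (real^('n option)) \<Rightarrow> _"
  assumes W: "transversal L W" and U: "open U" "p \<in> L \<inter> U" and E: "tangent_frame (L \<inter> U) E"
    and v: "G p \<bullet> v = 0"
    and \<theta>: "\<And>j. induced_conn L W (E j) p v = (\<Sum>i\<in>UNIV. \<theta> i j *\<^sub>R E i p)"
  shows "flat_deriv L (\<lambda>q. \<bar>interior_product (W q) Upsilon_form (\<lambda>i. E i q)\<bar>) p v
    = ((G p \<bullet> flat_deriv L W p v) / (G p \<bullet> W p) + (\<Sum>i\<in>UNIV. \<theta> i i))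
      * \<bar>interior_product (W p) Upsilon_form (\<lambda>i. E i p)\<bar>"
    and "\<bar>interior_product (W p) Upsilon_form (\<lambda>i. E i p)\<bar> > 0"
proof -
  note Ep = tangent_frameD[OF E U]
  have p: "p \<in> L" "p \<in> total_space" using U(2) by (auto simp: L_def)
  define f where "f q = Upsilon_form (case_option (W q) (\<lambda>i. E i q))" for q
  have Gw: "G p \<bullet> W p \<noteq> 0" using transversalD'[OF W p(1)] .
  have flat: "flat_deriv (L \<inter> U) Y p v = flat_deriv L Y p v" for Y :: "_ \<Rightarrow> 'z::real_normed_vector" and v
    using flat_deriv_Int U by blast
  have "smooth_along (L \<inter> U) W"
    using W smooth_along_subset unfolding transversal_def by blast
  note dW = smooth_along_has_derivative[OF this U(2)]
  obtain D where D: "(f has_derivative D) (at p within L \<inter> U)"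
    and D_eq: "\<And>v \<tau> s t \<theta>. flat_deriv (L \<inter> U) W p v = \<tau> *\<^sub>R W p + (\<Sum>i\<in>UNIV. s i *\<^sub>R E i p) \<Longrightarrow>
      (\<And>j. flat_deriv (L \<inter> U) (E j) p v = t j *\<^sub>R W p + (\<Sum>i\<in>UNIV. \<theta> i j *\<^sub>R E i p)) \<Longrightarrow>
      D v = (\<tau> + (\<Sum>i\<in>UNIV. \<theta> i i)) * f p"
  proof (rule Upsilon_has_derivative[where E = E, OF dW smooth_along_has_derivative[OF Ep(1) U(2)]])
    fix D assume a: "((\<lambda>q. Upsilon_form (case_option (W q) (\<lambda>i. E i q))) has_derivative D) (at p within L \<inter> U)"
      and b: "\<And>v \<tau> s t \<theta>. flat_deriv (L \<inter> U) W p v = \<tau> *\<^sub>R W p + (\<Sum>i\<in>UNIV. s i *\<^sub>R E i p) \<Longrightarrow>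
      (\<And>j. flat_deriv (L \<inter> U) (E j) p v = t j *\<^sub>R W p + (\<Sum>i\<in>UNIV. \<theta> i j *\<^sub>R E i p)) \<Longrightarrow>
      D v = (\<tau> + (\<Sum>i\<in>UNIV. \<theta> i i)) * Upsilon_form (case_option (W p) (\<lambda>i. E i p))"
    show thesis
      using a b unfolding f_def[symmetric] by (rule that)
  qed
  define \<tau> where "\<tau> = (G p \<bullet> flat_deriv L W p v) / (G p \<bullet> W p)"
  have "flat_deriv L W p v - \<tau> *\<^sub>R W p \<in> span (range (\<lambda>i. E i p))"
    unfolding Ep(5) using Gw by (simp add: inner_diff_right \<tau>_def)
  then obtain s where s: "flat_deriv L W p v - \<tau> *\<^sub>R W p = (\<Sum>i\<in>UNIV. s i *\<^sub>R E i p)"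
    by (rule span_familyE[OF Ep(3)])
  have "flat_deriv (L \<inter> U) W p v = \<tau> *\<^sub>R W p + (\<Sum>i\<in>UNIV. s i *\<^sub>R E i p)"
    unfolding flat s[symmetric] by simp
  moreover have "flat_deriv (L \<inter> U) (E j) p v = transv_coeff L W p (flat_deriv L (E j) p v) *\<^sub>R W p
      + (\<Sum>i\<in>UNIV. \<theta> i j *\<^sub>R E i p)" for j
    unfolding flat \<theta>[symmetric] by (simp add: induced_conn_def tang_part_def)
  ultimately have Dv: "D v = (\<tau> + (\<Sum>i\<in>UNIV. \<theta> i i)) * f p"
    by (rule D_eq)
  have "Upsilon_form (case_option (N p) (\<lambda>i. E i p)) \<noteq> 0"
    by (rule Upsilon_frame_nonzero[OF p(2) Ep(2) Ep(3,4)])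
  moreover have "\<bar>f p\<bar> = \<bar>G p \<bullet> W p\<bar> * \<bar>Upsilon_form (case_option (N p) (\<lambda>i. E i p))\<bar>"
    unfolding f_def by (rule abs_Upsilon_transversal[OF p(2) Ep(2)])
  ultimately have f0: "f p \<noteq> 0" using Gw by auto
  then show "\<bar>interior_product (W p) Upsilon_form (\<lambda>i. E i p)\<bar> > 0"
    by (simp add: interior_product_def f_def)
  have "v \<in> tangent_space (L \<inter> U) p" using tangent_space_L[OF U] v by simp
  from flat_deriv_eq[OF has_derivative_abs_nonzero[OF D U(2) f0] this]
  have "flat_deriv L (\<lambda>q. \<bar>f q\<bar>) p v = (\<tau> + (\<Sum>i\<in>UNIV. \<theta> i i)) * \<bar>f p\<bar>"
    unfolding flat Dv by (simp add: abs_sgn mult.left_commute mult.commute)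
  then show "flat_deriv L (\<lambda>q. \<bar>interior_product (W q) Upsilon_form (\<lambda>i. E i q)\<bar>) p v
    = ((G p \<bullet> flat_deriv L W p v) / (G p \<bullet> W p) + (\<Sum>i\<in>UNIV. \<theta> i i))
      * \<bar>interior_product (W p) Upsilon_form (\<lambda>i. E i p)\<bar>"
    by (simp add: interior_product_def f_def \<tau>_def)
qed

text \<open>The factor \<open>-1 / dF(W)\<close> is pulled out of 2n rows and the square root halves
  the exponent; \<open>Upsilon_hess\<close> rewrites the remaining Hessian determinant as a
  volume.\<close>

lemma volume_density_L:
  fixes X :: "'n + 'n \<Rightarrow> (real^'n) \<times> (real^('n option))"
  assumes "p \<in> L" "G p \<bullet> W p \<noteq> 0" "\<And>i. G p \<bullet> X i = 0"
  shows "volume_density (second_form L W) p X =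
    \<bar>\<kappa>\<bar> * \<bar>Upsilon_form (case_option (N p) X)\<bar> / \<bar>G p \<bullet> W p\<bar> ^ CARD('n)"
proof -
  let ?f = "G p \<bullet> W p"
  have "(\<chi> i j. second_form L W p (X i) (X j)) = (\<chi> i. (- 1 / ?f) *s (\<chi> j. hess p (X i) (X j)))"
    using second_form_L'[where T=W, OF assms(1,2)] assms(3) by (simp add: vec_eq_iff)
  then have "det (\<chi> i j. second_form L W p (X i) (X j)) =
      (- 1 / ?f) ^ CARD('n + 'n) * det (\<chi> i j. hess p (X i) (X j))"
    using det_rows_mul[of "\<lambda>_. - 1 / ?f" "\<lambda>i. \<chi> j. hess p (X i) (X j)"] by simp
  moreover have "(- 1 / ?f) ^ CARD('n + 'n) = (1 / \<bar>?f\<bar> ^ CARD('n))\<^sup>2"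
    by (simp add: power_add power2_eq_square power_divide power_mult_distrib[symmetric] abs_mult_self_eq)
  ultimately have "\<bar>det (\<chi> i j. second_form L W p (X i) (X j))\<bar> =
      (1 / \<bar>?f\<bar> ^ CARD('n))\<^sup>2 * (\<kappa>\<^sup>2 * (Upsilon_form (case_option (N p) X))\<^sup>2)"
    using Upsilon_hess[OF L_dom[OF assms(1)] assms(3)] by (simp add: abs_mult)
  also have "\<dots> = (\<bar>\<kappa>\<bar> * \<bar>Upsilon_form (case_option (N p) X)\<bar> / \<bar>?f\<bar> ^ CARD('n))\<^sup>2"
    by (simp add: power_mult_distrib power_divide)
  finally show ?thesis
    unfolding volume_density_def by simp
qed

text \<open>Two families of test vectors suffice: \<open>(0, DA(fst w))\<close> returns the squared
  length of \<open>DA(fst w)\<close>, which forces \<open>fst w = 0\<close>, and then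
  \<open>(axis i 1, 0)\<close> returns \<open>A_i \<bullet> snd w\<close>.\<close>

lemma hess_nondegenerate_right:
  assumes "p \<in> total_space" "G p \<bullet> w = 0" "\<And>v. G p \<bullet> v = 0 \<Longrightarrow> hess p v w = 0"
  shows "w = 0"
proof -
  note u = fst_dom[OF assms(1)]
  have lin: "linear (frechet_derivative G (at p))"
    by (rule linear_frechet_derivative[OF smooth_on_differentiable[OF smooth_G assms(1)]])
  have h: "hess p v w = 0" for v
  proof -
    have "hess p (v - (G p \<bullet> v) *\<^sub>R N p) w = 0"
      by (rule assms(3)) (simp add: inner_diff_right G_N[OF assms(1)])
    then show ?thesis using hess_N_left[OF assms(1), of w]
      by (simp add: hess_def linear_diff[OF lin] linear_scale[OF lin] inner_diff_left)
  qed
  let ?D = "frechet_derivative A (at (fst p)) (fst w)"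
  have "hess p (0, ?D) w = ?D \<bullet> ?D"
    by (simp add: hess_coordinates[OF assms(1)] DA[OF u] inner_sum_left mult.commute)
  then have "?D = 0" using h by simp
  moreover have "linear (frechet_derivative A (at (fst p)))"
    by (rule linear_frechet_derivative[OF smooth_on_differentiable[OF smooth_A u]])
  moreover have "inj (frechet_derivative A (at (fst p)))"
    using centroaffine u by (simp add: centroaffine_immersion_def)
  ultimately have w1: "fst w = 0"
    using linear_injective_0 by blast
  have "hess p (axis i 1, 0) w = Ai i (fst p) \<bullet> snd w" for i
    by (simp add: hess_coordinates[OF assms(1)] w1 axis_def if_distrib[of "\<lambda>x. x * _"] cong: if_cong)
  then have "Ai i (fst p) \<bullet> snd w = 0" for i using h by metis
  moreover have "A (fst p) \<bullet> snd w = 0"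
    using assms(2) by (simp add: G_def inner_prod_def w1)
  ultimately have "snd w = 0" by (rule fmat_kernel[OF u])
  with w1 show ?thesis by (simp add: prod_eq_iff)
qed


section \<open>Equiaffine normals\<close>

text \<open>The level set projects onto all of \<open>M\<close>, so that derivatives of the conormal
  can be examined at points of the level set.\<close>

lemma level_point:
  assumes "u \<in> M"
  obtains p where "p \<in> L" "fst p = u"
  using retr_in_L[of "(u, 0)"] fst_retr[of "(u, 0)"] assms that by (simp add: total_space_def)

lemma tangent_lift:
  assumes "p \<in> total_space"
  obtains v where "G p \<bullet> v = 0" "fst v = w"
proof
  let ?v = "(w, 0) - (G p \<bullet> (w, 0)) *\<^sub>R N p"
  show "G p \<bullet> ?v = 0" using G_N[OF assms] by (simp add: inner_diff_right)
  show "fst ?v = w" by (simp add: N_def)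
qed

lemma N_has_derivative:
  assumes "p \<in> total_space"
  shows "(N has_derivative (\<lambda>v. (0, frechet_derivative conormal (at (fst p)) (fst v)))) (at p)"
  unfolding N_def[abs_def]
  by (intro has_derivative_Pair has_derivative_const
      has_derivative_compose[OF has_derivative_fst[OF has_derivative_ident]
      smooth_on_has_derivative[OF smooth_conormal fst_dom[OF assms]]])

lemma pairing_has_derivative:
  assumes "smooth_along L Y" "p \<in> L"
  shows "((\<lambda>q. G q \<bullet> Y q) has_derivative flat_deriv L (\<lambda>q. G q \<bullet> Y q) p) (at p within L)"
proof -
  have "(\<lambda>q. G q \<bullet> Y q) differentiable (at p within L)"
    by (rule differentiableI[OF has_derivative_inner[OF
        has_derivative_at_withinI[OF G_has_derivative[OF L_dom[OF assms(2)]]]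
        smooth_along_has_derivative[OF assms]]])
  then show ?thesis
    unfolding frechet_derivative_works flat_deriv_def by simp
qed

text \<open>Both sides of the volume condition, evaluated on one tangent frame, contain the nonzero
  volume of \<open>(N, X)\<close>; cancelling it leaves powers of
  \<open>\<bar>dF(W)\<bar>\<close>.\<close>

lemma normal_scale:
  assumes W: "equiaffine_normal Upsilon_form L W" and p: "p \<in> L"
  shows "\<bar>G p \<bullet> W p\<bar> ^ Suc CARD('n) = \<bar>\<kappa>\<bar>"
proof -
  have tr: "transversal L W" using W by (simp add: equiaffine_normal_def)
  note Gw = transversalD'[OF tr p] and pd = L_dom[OF p]
  obtain U and E :: "'n + 'n \<Rightarrow> _" where U: "open U" "p \<in> U" and E: "tangent_frame (L \<inter> U) E"
    using tangent_frame_exists[OF p] .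
  have pU: "p \<in> L \<inter> U" using p U by simp
  note Ep = tangent_frameD[OF E U(1) pU]
  define X where "X = (\<lambda>i. E i p)"
  have X: "\<And>i. G p \<bullet> X i = 0" and nz: "Upsilon_form (case_option (N p) X) \<noteq> 0"
    unfolding X_def using Ep(2) Upsilon_frame_nonzero[OF pd Ep(2-4)] by blast+
  have "range X \<subseteq> tangent_space L p"
    using X by (auto simp: tangent_space_L'[OF p])
  then have "\<bar>interior_product (W p) Upsilon_form X\<bar> = volume_density (second_form L W) p X"
    using W p unfolding equiaffine_normal_def by blast
  then have "\<bar>G p \<bullet> W p\<bar> * \<bar>Upsilon_form (case_option (N p) X)\<bar>
      = \<bar>\<kappa>\<bar> * \<bar>Upsilon_form (case_option (N p) X)\<bar> / \<bar>G p \<bullet> W p\<bar> ^ CARD('n)"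
    using abs_Upsilon_transversal[OF pd X, of "W p"] volume_density_L[where W = W, OF p Gw X]
    by (simp only: interior_product_def)
  then show ?thesis using nz Gw by (simp add: field_simps)
qed

lemma normal_is_multiple:
  assumes W: "equiaffine_normal Upsilon_form L W" and p: "p \<in> L"
  shows "W p = (G p \<bullet> W p) *\<^sub>R N p"
    and "\<And>v. G p \<bullet> v = 0 \<Longrightarrow> flat_deriv L (\<lambda>q. G q \<bullet> W q) p v = 0"
    and "\<And>v. G p \<bullet> v = 0 \<Longrightarrow> G p \<bullet> flat_deriv L W p v = 0"
proof -
  have tr: "transversal L W" using W by (simp add: equiaffine_normal_def)
  note Gw = transversalD'[OF tr p] and pd = L_dom[OF p]
  have sW: "smooth_along L W" using tr by (simp add: transversal_def)
  have dGW: "((\<lambda>q. G q \<bullet> W q) has_derivative flat_deriv L (\<lambda>q. G q \<bullet> W q) p) (at p within L)"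
    by (rule pairing_has_derivative[OF sW p])
  have *: "flat_deriv L (\<lambda>q. G q \<bullet> W q) p v = 0 \<and> G p \<bullet> flat_deriv L W p v = 0"
    if v: "G p \<bullet> v = 0" for v
  proof
    have vT: "v \<in> tangent_space L p" using v by (simp add: tangent_space_L'[OF p])
    \<comment> \<open>Only \<open>\<bar>dF(W)\<bar>\<close> is known to be constant. The square has
      a derivative without any discussion of signs, and \<open>dF(W) \<noteq> 0\<close> then
      cancels.\<close>
    have sq: "(G q \<bullet> W q) * (G q \<bullet> W q) = (G p \<bullet> W p) * (G p \<bullet> W p)" if "q \<in> L" for q
    proof -
      have "\<bar>G q \<bullet> W q\<bar> = \<bar>G p \<bullet> W p\<bar>"
        by (rule power_inject_base[of _ "CARD('n)"])
          (simp_all only: normal_scale[OF W that] normal_scale[OF W p] abs_ge_zero)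
      then show ?thesis by (auto simp: abs_eq_iff)
    qed
    have "flat_deriv L (\<lambda>q. (G q \<bullet> W q) * (G q \<bullet> W q)) p v = 0"
      by (rule flat_deriv_locally_const'[OF p v]) (rule sq)
    moreover have "flat_deriv L (\<lambda>q. (G q \<bullet> W q) * (G q \<bullet> W q)) p v
        = (G p \<bullet> W p) * flat_deriv L (\<lambda>q. G q \<bullet> W q) p v + flat_deriv L (\<lambda>q. G q \<bullet> W q) p v * (G p \<bullet> W p)"
      by (rule flat_deriv_eq[OF has_derivative_mult[OF dGW dGW] vT])
    ultimately show "flat_deriv L (\<lambda>q. G q \<bullet> W q) p v = 0" using Gw by simp
    obtain U and E :: "'n + 'n \<Rightarrow> _" where U: "open U" "p \<in> U" and E: "tangent_frame (L \<inter> U) E"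
      using tangent_frame_exists[OF p] .
    have pU: "p \<in> L \<inter> U" using p U by simp
    note Ep = tangent_frameD[OF E U(1) pU]
    have "\<exists>c. induced_conn L W (E j) p v = (\<Sum>i\<in>UNIV. c i *\<^sub>R E i p)" for j
    proof -
      have "induced_conn L W (E j) p v \<in> span (range (\<lambda>i. E i p))"
        unfolding Ep(5) using Gw
        by (simp add: induced_conn_def tang_part_def transv_coeff_L'[where T=W, OF p Gw] inner_diff_right)
      then show ?thesis by (rule span_familyE[OF Ep(3)]) blast
    qed
    then have "\<exists>c. \<forall>j. induced_conn L W (E j) p v = (\<Sum>i\<in>UNIV. c j i *\<^sub>R E i p)"
      by (intro choice allI)
    then obtain c where c': "\<forall>j. induced_conn L W (E j) p v = (\<Sum>i\<in>UNIV. c j i *\<^sub>R E i p)" ..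
    note c = c'[rule_format]
    define \<rho> where "\<rho> = \<bar>interior_product (W p) Upsilon_form (\<lambda>i. E i p)\<bar>"
    have par: "parallel_density L W (\<lambda>p X. \<bar>interior_product (W p) Upsilon_form X\<bar>)"
      using W by (simp add: equiaffine_normal_def)
    \<comment> \<open>Parallelism gives the rate \<open>tr \<theta>\<close> and Jacobi's formula the
      rate \<open>\<tau> + tr \<theta>\<close>; since \<open>\<rho> > 0\<close>, comparison yields
      \<open>\<tau>(v) = 0\<close>.\<close>
    have "flat_deriv L (\<lambda>q. \<bar>interior_product (W q) Upsilon_form (\<lambda>i. E i q)\<bar>) p v = (\<Sum>i\<in>UNIV. c i i) * \<rho>"
      unfolding \<rho>_def
      by (rule par[unfolded parallel_density_def, rule_format, OF p conjI[OF U(1) conjI[OF U(2) E]] vT]) (rule c)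
    moreover have "flat_deriv L (\<lambda>q. \<bar>interior_product (W q) Upsilon_form (\<lambda>i. E i q)\<bar>) p v
        = ((G p \<bullet> flat_deriv L W p v) / (G p \<bullet> W p) + (\<Sum>i\<in>UNIV. c i i)) * \<rho>"
      unfolding \<rho>_def by (rule flat_deriv_density(1)[where \<theta> = "\<lambda>i j. c j i", OF tr U(1) pU E v c])
    moreover have "\<rho> > 0"
      unfolding \<rho>_def by (rule flat_deriv_density(2)[where \<theta> = "\<lambda>i j. c j i", OF tr U(1) pU E v c])
    ultimately show "G p \<bullet> flat_deriv L W p v = 0" using Gw by simp
  qed
  show "\<And>v. G p \<bullet> v = 0 \<Longrightarrow> flat_deriv L (\<lambda>q. G q \<bullet> W q) p v = 0"
    and "\<And>v. G p \<bullet> v = 0 \<Longrightarrow> G p \<bullet> flat_deriv L W p v = 0"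
    using * by blast+
  have "W p - (G p \<bullet> W p) *\<^sub>R N p = 0"
  proof (rule hess_nondegenerate_right[OF pd])
    show "G p \<bullet> (W p - (G p \<bullet> W p) *\<^sub>R N p) = 0" by (simp add: inner_diff_right G_N[OF pd])
    fix v assume v: "G p \<bullet> v = 0"
    have "hess p v (W p) = 0"
      using derivative_pairing'[OF sW p v] *[OF v] by simp
    then show "hess p v (W p - (G p \<bullet> W p) *\<^sub>R N p) = 0"
      by (simp add: hess_diff_right hess_scaleR_right hess_N_right[OF pd])
  qed
  then show "W p = (G p \<bullet> W p) *\<^sub>R N p" by simp
qed

lemma flat_deriv_normal:
  assumes W: "equiaffine_normal Upsilon_form L W" and p: "p \<in> L" and v: "G p \<bullet> v = 0"
  shows "flat_deriv L W p v = (G p \<bullet> W p) *\<^sub>R (0, frechet_derivative conormal (at (fst p)) (fst v))"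
proof -
  have tr: "transversal L W" using W by (simp add: equiaffine_normal_def)
  have sW: "smooth_along L W" using tr by (simp add: transversal_def)
  note pd = L_dom[OF p]
  have "((\<lambda>q. G q \<bullet> W q) has_derivative flat_deriv L (\<lambda>q. G q \<bullet> W q) p) (at p within L)"
    by (rule pairing_has_derivative[OF sW p])
  from has_derivative_scaleR[OF this has_derivative_at_withinI[OF N_has_derivative[OF pd]]]
  have "(W has_derivative (\<lambda>v. (G p \<bullet> W p) *\<^sub>R (0, frechet_derivative conormal (at (fst p)) (fst v))
      + flat_deriv L (\<lambda>q. G q \<bullet> W q) p v *\<^sub>R N p)) (at p within L)"
    by (rule has_derivative_transform_within[where d = 1])
      (use p normal_is_multiple(1)[OF W] in simp_all)
  from flat_deriv_eq[OF this, of v] show ?thesis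
    using v normal_is_multiple(2)[OF W p v] by (simp add: tangent_space_L'[OF p])
qed

section \<open>Affine spheres and hyperplanes\<close>

lemma affine_sphere_imp_hyperplane:
  assumes conn: "connected M" and ne: "M \<noteq> {}" and sphere: "affine_sphere Upsilon_form L"
  shows "\<exists>a b. a \<noteq> 0 \<and> A ` M \<subseteq> {y. a \<bullet> y = b}"
proof -
  obtain W where W: "equiaffine_normal Upsilon_form L W"
    and H: "\<forall>p\<in>L. \<exists>H. \<forall>v\<in>tangent_space L p. shape_op L W p v = H *\<^sub>R v"
    using sphere unfolding affine_sphere_def by blast
  have tr: "transversal L W" using W by (simp add: equiaffine_normal_def)
  have zero: "frechet_derivative conormal (at u) w = 0" if u: "u \<in> M" for u w
  proof -
    obtain p where p: "p \<in> L" "fst p = u" using level_point[OF u] .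
    note pd = L_dom[OF p(1)] and Gw = transversalD'[OF tr p(1)]
    \<comment> \<open>As \<open>\<tau> = 0\<close>, the derivative of \<open>W\<close> is already
      tangent.\<close>
    have shape: "shape_op L W p v = - flat_deriv L W p v" if "G p \<bullet> v = 0" for v
      using normal_is_multiple(3)[OF W p(1) that]
      by (simp add: shape_op_def tang_part_def transv_coeff_L'[where T=W, OF p(1) Gw])
    obtain h where h: "\<And>v. G p \<bullet> v = 0 \<Longrightarrow> shape_op L W p v = h *\<^sub>R v"
      using H[rule_format, OF p(1)] unfolding tangent_space_L'[OF p(1)] by blast
    \<comment> \<open>This is where n \<ge> 1 enters: some \<open>y \<noteq> 0\<close> is orthogonal
      to \<open>A u\<close>, and \<open>(0, y)\<close> is a vertical tangent vector, along which
      \<open>N\<close> has zero derivative. Hence \<open>h = 0\<close>.\<close>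
    have "2 \<le> DIM(real^('n option))" by simp
    then obtain y where y: "y \<noteq> 0" "orthogonal (A u) y"
      using orthogonal_to_vector_exists by blast
    have "G p \<bullet> (0, y) = 0" using y(2) p(2) by (simp add: G_def orthogonal_def)
    from h[OF this] shape[OF this] flat_deriv_normal[OF W p(1) this]
    have "h *\<^sub>R (0 :: real^'n, y) = - ((G p \<bullet> W p) *\<^sub>R (0, frechet_derivative conormal (at (fst p)) 0))"
      by simp
    also have "\<dots> = 0"
      using frechet_zero[OF smooth_conormal fst_dom[OF pd]] by (simp add: zero_prod_def)
    finally have h0: "h = 0" using y(1) by (simp add: zero_prod_def)
    \<comment> \<open>Every direction \<open>w\<close> in \<open>M\<close> lifts to a tangent
      vector, so a zero shape operator reaches all derivatives of the conormal.\<close>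
    obtain v where v: "G p \<bullet> v = 0" "fst v = w" using tangent_lift[OF pd] .
    from h[OF v(1)] shape[OF v(1)] flat_deriv_normal[OF W p(1) v(1)]
    show ?thesis using Gw by (simp add: h0 v(2) p(2) zero_prod_def)
  qed
  have der: "(conormal has_derivative (\<lambda>h. 0)) (at u)" if "u \<in> M" for u
  proof -
    have "frechet_derivative conormal (at u) = (\<lambda>h. 0)" using zero[OF that] by (rule ext)
    with smooth_on_has_derivative[OF smooth_conormal that] show ?thesis by (simp only:)
  qed
  obtain u0 where u0: "u0 \<in> M" using ne by blast
  have "conormal u = conormal u0" if "u \<in> M" for u
  proof (rule has_derivative_zero_unique_strong_connected[OF conn open_M finite.emptyI
        smooth_on_continuous_on[OF smooth_conormal] u0 refl _ that])
    show "(conormal has_derivative (\<lambda>h. 0)) (at x within M)" if "x \<in> M - {}" for x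
      using that by (intro has_derivative_at_withinI[OF der]) simp
  qed
  then have "A ` M \<subseteq> {y. conormal u0 \<bullet> y = 1}"
    using conormal_A by auto
  moreover have "conormal u0 \<noteq> 0" using conormal_A[OF u0] by auto
  ultimately show ?thesis by blast
qed

text \<open>Differentiating \<open>a \<bullet> A = b\<close> gives
  \<open>a \<bullet> A_i = 0\<close>, so \<open>a - b *\<^sub>R conormal u\<close> annihilates the
  basis \<open>A, A_i\<close>. If \<open>b\<close> were 0, then \<open>a\<close> would
  vanish.\<close>

lemma hyperplane_imp_conormal:
  assumes a: "a \<noteq> 0" "A ` M \<subseteq> {y. a \<bullet> y = b}" and u: "u \<in> M"
  shows "conormal u = (1 / b) *\<^sub>R a"
proof -
  have aAi: "a \<bullet> Ai i u = 0" for i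
  proof -
    have "((\<lambda>u. a \<bullet> A u) has_derivative (\<lambda>w. a \<bullet> frechet_derivative A (at u) w)) (at u)"
      by (intro has_derivative_inner_right smooth_on_has_derivative[OF smooth_A u])
    moreover have "((\<lambda>u. a \<bullet> A u) has_derivative (\<lambda>w. 0)) (at u)"
      by (rule has_derivative_transform_within_open[OF has_derivative_const open_M u, of b]) (use a in auto)
    ultimately have "(\<lambda>w. a \<bullet> frechet_derivative A (at u) w) = (\<lambda>w. 0)"
      by (rule has_derivative_unique)
    then show ?thesis unfolding Ai_def by (rule fun_cong)
  qed
  have aA: "a \<bullet> A u = b" using a u by auto
  have "a - b *\<^sub>R conormal u = 0"
    by (rule fmat_kernel[OF u])
      (simp_all add: inner_diff_right inner_commute[of _ a] inner_commute[of _ "conormal u"] aAi aA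
        conormal_Ai conormal_A[OF u])
  moreover from this have "b \<noteq> 0" using a(1) by auto
  ultimately show ?thesis by (simp add: eq_iff_diff_eq_0[symmetric])
qed

text \<open>Here the conormal is constant, hence so is \<open>W\<close>: both \<open>\<tau>\<close>
  and the shape operator vanish, and the level set is an improper affine sphere.\<close>

lemma hyperplane_imp_affine_sphere:
  assumes a: "a \<noteq> 0" "A ` M \<subseteq> {y. a \<bullet> y = b}"
  shows "affine_sphere Upsilon_form L"
proof -
  \<comment> \<open>The positive scale imposed by \<open>normal_scale\<close>.\<close>
  define r where "r = root (Suc CARD('n)) \<bar>\<kappa>\<bar>"
  have l: "r > 0" "r ^ Suc CARD('n) = \<bar>\<kappa>\<bar>"
    using kappa_nz unfolding r_def by (simp, intro real_root_pow_pos2) simp_all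
  define W where "W q = r *\<^sub>R N q" for q
  have GW: "G p \<bullet> W p = r" if "p \<in> L" for p
    using G_N[OF L_dom[OF that]] by (simp add: W_def)
  have const: "W q = (0, (r / b) *\<^sub>R a)" if "q \<in> L" for q
    using hyperplane_imp_conormal[OF assms fst_dom[OF L_dom[OF that]]] by (simp add: W_def N_def)
  have "smooth_along L W"
    unfolding W_def[abs_def]
    by (rule smooth_along_restrict[OF smooth_on_scaleR[OF open_dom smooth_on_const[OF open_dom] smooth_N] open_dom])
      (auto simp: L_def)
  then have tr: "transversal L W"
    using GW l(1) by (simp add: transversal_def tangent_space_L')
  have dW: "flat_deriv L W p v = 0" if "p \<in> L" "G p \<bullet> v = 0" for p v
    by (rule flat_deriv_locally_const'[OF that const])
  have "equiaffine_normal Upsilon_form L W"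
    unfolding equiaffine_normal_def
  proof (intro conjI ballI allI impI tr)
    fix p and X :: "'n + 'n \<Rightarrow> _" assume p: "p \<in> L" and X: "range X \<subseteq> tangent_space L p"
    have X': "G p \<bullet> X i = 0" for i using X by (auto simp: tangent_space_L'[OF p])
    have "volume_density (second_form L W) p X = \<bar>\<kappa>\<bar> * \<bar>Upsilon_form (case_option (N p) X)\<bar> / r ^ CARD('n)"
      using volume_density_L[where W = W, OF p _ X'] GW[OF p] l(1) by simp
    also have "\<dots> = r * \<bar>Upsilon_form (case_option (N p) X)\<bar>"
      using l by (simp add: l(2)[symmetric])
    also have "\<dots> = \<bar>interior_product (W p) Upsilon_form X\<bar>"
      using abs_Upsilon_transversal[OF L_dom[OF p] X', of "W p"] l(1) by (simp only: interior_product_def GW[OF p] abs_of_pos)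
    finally show "\<bar>interior_product (W p) Upsilon_form X\<bar> = volume_density (second_form L W) p X" ..
  next
    show "parallel_density L W (\<lambda>p X. \<bar>interior_product (W p) Upsilon_form X\<bar>)"
      unfolding parallel_density_def
    proof (intro ballI allI impI, elim conjE)
      fix p U v and E :: "'n + 'n \<Rightarrow> _" and \<theta> :: "'n + 'n \<Rightarrow> 'n + 'n \<Rightarrow> real"
      assume p: "p \<in> L" and U: "open U" "p \<in> U" and E: "tangent_frame (L \<inter> U) E"
        and v: "v \<in> tangent_space L p"
        and \<theta>: "\<forall>j. induced_conn L W (E j) p v = (\<Sum>i\<in>UNIV. \<theta> i j *\<^sub>R E i p)"
      have v': "G p \<bullet> v = 0" using v by (simp add: tangent_space_L'[OF p])
      have pU: "p \<in> L \<inter> U" using p U by simp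
      show "flat_deriv L (\<lambda>q. \<bar>interior_product (W q) Upsilon_form (\<lambda>i. E i q)\<bar>) p v
        = (\<Sum>i\<in>UNIV. \<theta> i i) * \<bar>interior_product (W p) Upsilon_form (\<lambda>i. E i p)\<bar>"
        using flat_deriv_density(1)[where \<theta> = \<theta>, OF tr U(1) pU E v' \<theta>[rule_format]]
        by (simp add: dW[OF p v'])
    qed
  qed
  moreover have "shape_op L W p v = 0 *\<^sub>R v" if "p \<in> L" "v \<in> tangent_space L p" for p v
  proof -
    have v: "G p \<bullet> v = 0" using that by (simp add: tangent_space_L')
    have Gw: "G p \<bullet> W p \<noteq> 0" using GW that l by simp
    show ?thesis
      by (simp add: shape_op_def tang_part_def dW[OF that(1) v] transv_coeff_L'[where T=W, OF that(1) Gw])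
  qed
  ultimately show ?thesis
    unfolding affine_sphere_def using nondegenerate_hypersurface_L by blast
qed

text \<open>The retraction fixes \<open>L\<close> pointwise, so \<open>L\<close> is a continuous
  image of the product of \<open>M\<close> with a vector space.\<close>

lemma connected_L:
  assumes "connected M"
  shows "connected L"
proof -
  have "connected (retr ` total_space)"
    by (rule connected_continuous_image[OF smooth_on_continuous_on[OF smooth_retr]])
      (simp add: total_space_def connected_Times assms connected_UNIV)
  moreover have "retr ` total_space = L"
    using retr_in_L retr_on_L L_dom by (auto simp: image_iff) (metis)
  ultimately show ?thesis by simp
qed

end

theorem lemma3p2:
  fixes M :: "(real^'n::finite) set"
    and Q :: "real^'n \<Rightarrow> real"
    and A :: "real^'n \<Rightarrow> real^('n option)"
    and \<kappa> c :: real
    and \<Sigma> :: "((real^'n) \<times> (real^('n option))) set"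
  assumes "open M" "connected M" "M \<noteq> {}"
    and "smooth_on M Q"
    and "centroaffine_immersion M A"
    and "\<kappa> \<noteq> 0"
    and "\<forall>u\<in>M. \<forall>X. pullback_form A mu_form u X = \<kappa> * omega_form X"
    and "\<Sigma> \<in> components {p \<in> M \<times> UNIV. pairing_function A Q p = c}"
  shows "affine_sphere Upsilon_form \<Sigma> \<longleftrightarrow>
         (\<exists>a b. a \<noteq> 0 \<and> A ` M \<subseteq> {y. a \<bullet> y = b})"
proof -
  interpret pairing_data M Q A \<kappa> c
    by unfold_locales (fact assms)+
  have "\<Sigma> \<in> components L"
    using assms(8) by (simp only: L_def total_space_def F_def)
  moreover have "components L \<subseteq> {L}"
    using connected_L[OF assms(2)] by (simp only: connected_eq_components_subset_sing)
  ultimately have "\<Sigma> = L" by blast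
  then show ?thesis
    using affine_sphere_imp_hyperplane[OF assms(2,3)] hyperplane_imp_affine_sphere by blast
qed

end
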